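(* Let $F:\mathbb{R}^d\times\mathbb{R}^d\to\mathbb{R}^d$ be measurable with $\sup_{(z,a)}\frac{\|F(z,a)\|}{\|z\|+\|a\|}<\frac12$, let $\{v_t\}_{t\ge0}$ be i.i.d. random vectors whose common distribution has a density $g$ supported on a compact set $V\subset\mathbb{R}^d$ with finite differential entropy $h(g)$, and let $\mathsf{Z}=\mathsf{A}$ be a compact subset of $\mathbb{R}^d$ such that $V\subset\mathsf{Z}$ and $F(z,a)+v\in\mathsf{Z}$ for all $z,a\in\mathsf{Z}$, $v\in V$. Consider the Markov decision process with state space $\mathsf{Z}$, action space $\mathsf{A}$, dynamics $z_{t+1}=F(z_t,a_t)+v_t$, $t=0,1,2,\dots$, one-stage cost $c(z,a)=\|z-a\|$, and initial distribution $\mu$ with density $g$. Its optimal stationary policy is $f^*(z)=z$, with $J(f^*,\mu)=V(f^*,\mu)=0$. For $n\ge1$ let $\hat f_n:\mathsf{Z}\to\mathsf{A}$ be the piecewise constant extension of an optimal deterministic stationary policy $f_n^*$ of the $n$-state approximating model MDP$_n$ described in the context (for the discounted, respectively average, cost). Then there is a constant $L>0$, independent of $n$, such that for all $n\ge1$ $$|J(f^*,\mu)-J(\hat f_n,\mu)|\ge\frac{L}{1-\beta}(1/n)^{1/d}\quad\text{and}\quad|V(f^*,\mu)-V(\hat f_n,\mu)|\ge L(1/n)^{1/d}.$$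
   Context: The discounted and average costs of a policy $\pi$ with initial distribution $\mu$ are $J(\pi,\mu)=\mathbb{E}_\mu^\pi[\sum_{t\ge0}\beta^tc(z_t,a_t)]$ with $\beta\in(0,1)$, and $V(\pi,\mu)=\limsup_{T\to\infty}\frac1T\mathbb{E}_\mu^\pi[\sum_{t=0}^{T-1}c(z_t,a_t)]$. A deterministic stationary policy is a measurable map $f$ from states to actions applied as $a_t=f(z_t)$. The initial state and the noise sequence $\{v_t\}$ are independent. The differential entropy is $h(g)=-\int g(z)\log g(z)\,dz$. $\|\cdot\|$ is the Euclidean norm. MDP$_n$: let $p(\cdot|z,a)$ be the law of $F(z,a)+v_0$. Fix a set $\mathsf{Z}_n=\{z_{n,1},\dots,z_{n,n}\}\subset\mathsf{Z}$ of $n$ points, the measurable nearest-neighbour map $Q_n:\mathsf{Z}\to\mathsf{Z}_n$, cells $\mathcal{S}_{n,i}=Q_n^{-1}(z_{n,i})$, a probability measure $\nu_n$ on $\mathsf{Z}$ with $\nu_n(\mathcal{S}_{n,i})>0$ for all $i$, and $\nu_{n,i}(\cdot)=\nu_n(\cdot)/\nu_n(\mathcal{S}_{n,i})$ on $\mathcal{S}_{n,i}$. MDP$_n$ has state space $\mathsf{Z}_n$, action space $\mathsf{A}$, cost $c_n(z_{n,i},a)=\int_{\mathcal{S}_{n,i}}c(z,a)\nu_{n,i}(dz)$ and transition probability $p_n(z_{n,j}|z_{n,i},a)=\int_{\mathcal{S}_{n,i}}p(\mathcal{S}_{n,j}|z,a)\nu_{n,i}(dz)$. The piecewise constant extension of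 $f_n^*:\mathsf{Z}_n\to\mathsf{A}$ is $\hat f_n=f_n^*\circ Q_n$. *)

theory Defs
  imports "HOL-Probability.Probability"
begin

record ('s, 'a) mdp =
  states :: "'s measure"
  actions :: "'a measure"
  transition :: "'s \<Rightarrow> 'a \<Rightarrow> 's measure"
  cost :: "'s \<Rightarrow> 'a \<Rightarrow> real"

abbreviation state_action_space :: "('s, 'a) mdp \<Rightarrow> ('s \<times> 'a) measure" where
  "state_action_space m \<equiv> states m \<Otimes>\<^sub>M actions m"

text \<open>A general (history dependent, randomised) policy: \<open>\<pi> t (h, z)\<close> is the law of the action at
  time \<open>t\<close>, given the state-action pairs \<open>h 0, \<dots>, h (t - 1)\<close> of the past and the current state \<open>z\<close>.\<close>

type_synonym ('s, 'a) policy = "nat \<Rightarrow> (nat \<Rightarrow> 's \<times> 'a) \<times> 's \<Rightarrow> 'a measure"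

definition policies :: "('s, 'a) mdp \<Rightarrow> ('s, 'a) policy set" where
  "policies m = {\<pi>. \<forall>t. \<pi> t \<in>
     (PiM {0..<t} (\<lambda>_. state_action_space m) \<Otimes>\<^sub>M states m) \<rightarrow>\<^sub>M prob_algebra (actions m)}"

definition stationary :: "('s, 'a) mdp \<Rightarrow> ('s \<Rightarrow> 'a) \<Rightarrow> ('s, 'a) policy" where
  "stationary m f = (\<lambda>t (h, z). return (actions m) (f z))"

definition stage_kernel ::
  "('s, 'a) mdp \<Rightarrow> 's measure \<Rightarrow> ('s, 'a) policy \<Rightarrow> nat \<Rightarrow> (nat \<Rightarrow> 's \<times> 'a) \<Rightarrow> ('s \<times> 'a) measure" where
  "stage_kernel m \<mu> \<pi> t h =
     (if t = 0 then \<mu> else case h (t - 1) of (z, a) \<Rightarrow> transition m z a) \<bind>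
       (\<lambda>z. \<pi> t (h, z) \<bind> (\<lambda>a. return (state_action_space m) (z, a)))"

text \<open>The law of \<open>(z\<^sub>t, a\<^sub>t)\<^sub>t\<close> under the policy \<open>\<pi>\<close> and the initial distribution \<open>\<mu>\<close>,
  given by the Ionescu-Tulcea theorem. The expectation with respect to it is the one usually
  decorated with superscript \<open>\<pi>\<close> and subscript \<open>\<mu>\<close>.\<close>

definition path_measure ::
  "('s, 'a) mdp \<Rightarrow> 's measure \<Rightarrow> ('s, 'a) policy \<Rightarrow> (nat \<Rightarrow> 's \<times> 'a) measure" where
  "path_measure m \<mu> \<pi> =
     projective_family.lim UNIV
       (Ionescu_Tulcea.CI (stage_kernel m \<mu> \<pi>) (\<lambda>_. state_action_space m))
       (\<lambda>_. state_action_space m)"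

definition discounted_cost ::
  "('s, 'a) mdp \<Rightarrow> real \<Rightarrow> ('s, 'a) policy \<Rightarrow> 's measure \<Rightarrow> real" where
  "discounted_cost m \<beta> \<pi> \<mu> =
     (\<integral>\<omega>. (\<Sum>t. \<beta> ^ t * cost m (fst (\<omega> t)) (snd (\<omega> t))) \<partial>path_measure m \<mu> \<pi>)"

definition average_cost ::
  "('s, 'a) mdp \<Rightarrow> ('s, 'a) policy \<Rightarrow> 's measure \<Rightarrow> ereal" where
  "average_cost m \<pi> \<mu> =
     limsup (\<lambda>T. ereal (1 / real T *
       (\<integral>\<omega>. (\<Sum>t<T. cost m (fst (\<omega> t)) (snd (\<omega> t))) \<partial>path_measure m \<mu> \<pi>)))"

text \<open>A deterministic stationary policy \<open>f\<close> is optimal for the cost functional \<open>J\<close> and the initial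
  distributions in \<open>I\<close> if no policy whatsoever does better from any of them.\<close>

definition optimal_stationary ::
  "('s, 'a) mdp \<Rightarrow> (('s, 'a) policy \<Rightarrow> 's measure \<Rightarrow> 'c::order) \<Rightarrow> 's measure set \<Rightarrow> ('s \<Rightarrow> 'a) \<Rightarrow> bool" where
  "optimal_stationary m J I f \<longleftrightarrow>
     f \<in> states m \<rightarrow>\<^sub>M actions m \<and>
     (\<forall>\<mu>\<in>I. \<forall>\<pi>\<in>policies m. J (stationary m f) \<mu> \<le> J \<pi> \<mu>)"

abbreviation dirac_distributions :: "('s, 'a) mdp \<Rightarrow> 's measure set" where
  "dirac_distributions m \<equiv> return (states m) ` space (states m)"

text \<open>The law of \<open>F z a + v\<close> is concentrated on \<open>Z\<close> for \<open>z\<close>, \<open>a\<close> in \<open>Z\<close>, and is regarded as a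
  measure on the state space \<open>Z\<close>.\<close>

definition additive_noise_mdp ::
  "'e::euclidean_space set \<Rightarrow> ('e \<Rightarrow> 'e \<Rightarrow> 'e) \<Rightarrow> 'w measure \<Rightarrow> ('w \<Rightarrow> 'e) \<Rightarrow> ('e, 'e) mdp" where
  "additive_noise_mdp Z F M v =
     \<lparr> states = restrict_space borel Z,
       actions = restrict_space borel Z,
       transition = (\<lambda>z a. restrict_space (distr M borel (\<lambda>\<omega>. F z a + v \<omega>)) Z),
       cost = (\<lambda>z a. norm (z - a)) \<rparr>"

definition nearest_neighbour_map ::
  "'e::euclidean_space set \<Rightarrow> 'e set \<Rightarrow> ('e \<Rightarrow> 'e) \<Rightarrow> bool" where
  "nearest_neighbour_map Z Y Q \<longleftrightarrow>
     Q \<in> restrict_space borel Z \<rightarrow>\<^sub>M count_space Y \<and>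
     (\<forall>z\<in>Z. \<forall>y\<in>Y. norm (z - Q z) \<le> norm (z - y))"

definition cell :: "('s, 'a) mdp \<Rightarrow> ('s \<Rightarrow> 's) \<Rightarrow> 's \<Rightarrow> 's set" where
  "cell m Q y = {z \<in> space (states m). Q z = y}"

text \<open>The finite state approximation with state space \<open>Y\<close>. Here \<open>uniform_measure \<nu> B\<close> is
  the normalised restriction of \<open>\<nu>\<close> to \<open>B\<close>.\<close>

definition approx_mdp ::
  "('s, 'a) mdp \<Rightarrow> 's set \<Rightarrow> ('s \<Rightarrow> 's) \<Rightarrow> 's measure \<Rightarrow> ('s, 'a) mdp" where
  "approx_mdp m Y Q \<nu> =
     \<lparr> states = count_space Y,
       actions = actions m,
       transition = (\<lambda>y a. point_measure Y (\<lambda>y'.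
         \<integral>\<^sup>+z. emeasure (transition m z a) (cell m Q y') \<partial>uniform_measure \<nu> (cell m Q y))),
       cost = (\<lambda>y a. \<integral>z. cost m z a \<partial>uniform_measure \<nu> (cell m Q y)) \<rparr>"

text \<open>The constructions above are well defined: every policy has a path measure, and
  the transition functions of both processes are probability kernels.\<close>

lemma stationary_in_policies: "f \<in> states m \<rightarrow>\<^sub>M actions m \<Longrightarrow> stationary m f \<in> policies m"
  unfolding policies_def stationary_def
  by (auto simp: split_beta' )

lemma Ionescu_Tulcea_stage_kernel:
  assumes tr: "(\<lambda>(z, a). transition m z a) \<in> states m \<Otimes>\<^sub>M actions m \<rightarrow>\<^sub>M prob_algebra (states m)"
   and mu: "\<mu> \<in> space (prob_algebra (states m))" and pi: "\<pi> \<in> policies m"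
  shows "Ionescu_Tulcea (stage_kernel m \<mu> \<pi>) (\<lambda>_. state_action_space m)"
proof -
  let ?SA = "state_action_space m" and ?H = "\<lambda>t. PiM {0..<t} (\<lambda>_. state_action_space m)"
  have pm: "\<pi> t \<in> (?H t \<Otimes>\<^sub>M states m) \<rightarrow>\<^sub>M prob_algebra (actions m)" for t
    using pi by (simp add: policies_def)
  have ret: "(\<lambda>(p, a). return ?SA (snd p, a)) \<in> (?H t \<Otimes>\<^sub>M states m) \<Otimes>\<^sub>M actions m \<rightarrow>\<^sub>M prob_algebra ?SA" for t
    unfolding split_beta'
    by (intro measurable_compose[OF _ measurable_return_prob_space] measurable_Pair
        measurable_compose[OF measurable_fst measurable_snd] measurable_snd)
  have inner: "(\<lambda>(h, z). \<pi> t (h, z) \<bind> (\<lambda>a. return ?SA (z, a))) \<in> ?H t \<Otimes>\<^sub>M states m \<rightarrow>\<^sub>M prob_algebra ?SA" for t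
    using measurable_bind_prob_space2[OF pm ret] by (simp add: split_beta')
  have k: "stage_kernel m \<mu> \<pi> t \<in> ?H t \<rightarrow>\<^sub>M prob_algebra ?SA" for t
  proof -
    have "(\<lambda>h. if t = 0 then \<mu> else case h (t - 1) of (z, a) \<Rightarrow> transition m z a) \<in> ?H t \<rightarrow>\<^sub>M prob_algebra (states m)"
    proof (cases "t = 0")
      case True
      then show ?thesis using mu by simp
    next
      case False
      then have "(\<lambda>h. h (t - 1)) \<in> ?H t \<rightarrow>\<^sub>M ?SA"
        by (intro measurable_component_singleton) auto
      from measurable_compose[OF this tr] False show ?thesis by simp
    qed
    from measurable_bind_prob_space2[OF this inner] show ?thesis
      unfolding stage_kernel_def .
  qed
  show ?thesis
  proof (rule Ionescu_Tulcea.intro)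
    fix t
    show "stage_kernel m \<mu> \<pi> t \<in> ?H t \<rightarrow>\<^sub>M subprob_algebra ?SA"
      using k by (rule measurable_prob_algebraD)
    fix h assume "h \<in> space (?H t)"
    from measurable_space[OF k this] show "prob_space (stage_kernel m \<mu> \<pi> t h)"
      by (simp add: space_prob_algebra)
  qed
qed

lemma transition_additive_noise:
  fixes F :: "'e::euclidean_space \<Rightarrow> 'e \<Rightarrow> 'e"
  assumes [measurable]: "(\<lambda>(z, a). F z a) \<in> borel_measurable (borel \<Otimes>\<^sub>M borel)"
   and M: "prob_space M" and [measurable]: "v \<in> borel_measurable M" and ae: "AE \<omega> in M. v \<omega> \<in> V"
   and Z: "compact Z" and inv: "\<And>z a x. z \<in> Z \<Longrightarrow> a \<in> Z \<Longrightarrow> x \<in> V \<Longrightarrow> F z a + x \<in> Z"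
   and m: "m = additive_noise_mdp Z F M v"
  shows "(\<lambda>(z, a). transition m z a) \<in> states m \<Otimes>\<^sub>M actions m \<rightarrow>\<^sub>M prob_algebra (states m)"
proof (rule measurable_prob_algebra_generated[where G="sets (restrict_space borel Z)" and \<Omega>=Z])
  interpret M: prob_space M by fact
  have [measurable]: "Z \<in> sets borel" using Z by (auto dest: compact_imp_closed)
  have id[measurable]: "(\<lambda>x. x) \<in> restrict_space borel Z \<rightarrow>\<^sub>M borel" by (simp add: measurable_restrict_space1)
  show "sets (states m) = sigma_sets Z (sets (restrict_space borel Z))"
    using sets.sigma_sets_eq[of "restrict_space borel Z"] by (simp add: m additive_noise_mdp_def space_restrict_space)
  show "Int_stable (sets (restrict_space borel Z))" by (rule sets.Int_stable)
  show "sets (restrict_space borel Z) \<subseteq> Pow Z" using sets.space_closed[of "restrict_space borel Z"]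
    by (simp add: space_restrict_space)
  show "prob_space ((\<lambda>(z, a). transition m z a) x)" if "x \<in> space (states m \<Otimes>\<^sub>M actions m)" for x
  proof -
    define z a where "z = fst x" and "a = snd x"
    have x: "x = (z, a)" "z \<in> Z" "a \<in> Z" using that
      by (auto simp: m additive_noise_mdp_def space_pair_measure space_restrict_space z_def a_def)
    have "emeasure (distr M borel (\<lambda>\<omega>. F z a + v \<omega>)) Z = 1"
    proof -
      have "AE \<omega> in M. F z a + v \<omega> \<in> Z"
        using ae by (rule AE_mp) (rule AE_I2, simp add: inv x)
      then have "emeasure M {\<omega> \<in> space M. F z a + v \<omega> \<in> Z} = 1"
        by (intro M.emeasure_eq_1_AE) auto
      then show ?thesis
        by (simp add: emeasure_distr vimage_def Int_def conj_commute)
    qed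
    then show ?thesis by (auto intro!: prob_spaceI simp: x m additive_noise_mdp_def emeasure_restrict_space space_restrict_space)
  qed
  show "sets ((\<lambda>(z, a). transition m z a) x) = sets (states m)" for x
    by (auto simp: m additive_noise_mdp_def sets_restrict_space split: prod.split)
  show "(\<lambda>x. emeasure ((\<lambda>(z, a). transition m z a) x) A) \<in> borel_measurable (states m \<Otimes>\<^sub>M actions m)"
    if A: "A \<in> sets (restrict_space borel Z)" for A
  proof -
    have [measurable]: "A \<in> sets borel" "A \<subseteq> Z" using A by (auto simp: sets_restrict_space)
    have eq: "emeasure ((\<lambda>(z, a). transition m z a) x) A = (\<integral>\<^sup>+\<omega>. indicator A (F (fst x) (snd x) + v \<omega>) \<partial>M)" for x
    proof -
      have "emeasure ((\<lambda>(z, a). transition m z a) x) A = emeasure (distr M borel (\<lambda>\<omega>. F (fst x) (snd x) + v \<omega>)) A"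
        by (auto simp: m additive_noise_mdp_def emeasure_restrict_space \<open>A \<subseteq> Z\<close> split: prod.split)
      also have "\<dots> = (\<integral>\<^sup>+y. indicator A y \<partial>distr M borel (\<lambda>\<omega>. F (fst x) (snd x) + v \<omega>))" by simp
      also have "\<dots> = (\<integral>\<^sup>+\<omega>. indicator A (F (fst x) (snd x) + v \<omega>) \<partial>M)" by (subst nn_integral_distr) auto
      finally show ?thesis .
    qed
    have F': "(\<lambda>x. F (fst x) (snd x)) \<in> borel_measurable (restrict_space borel Z \<Otimes>\<^sub>M restrict_space borel Z)"
      using measurable_compose[OF measurable_Pair[OF measurable_compose[OF measurable_fst id] measurable_compose[OF measurable_snd id]] assms(1)]
      by (simp add: split_beta')
    have "(\<lambda>x. \<integral>\<^sup>+\<omega>. indicator A (F (fst x) (snd x) + v \<omega>) \<partial>M) \<in> borel_measurable (restrict_space borel Z \<Otimes>\<^sub>M restrict_space borel Z)"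
    proof (rule M.borel_measurable_nn_integral)
      have "(\<lambda>p. F (fst (fst p)) (snd (fst p)) + v (snd p)) \<in> borel_measurable ((restrict_space borel Z \<Otimes>\<^sub>M restrict_space borel Z) \<Otimes>\<^sub>M M)"
        by (intro borel_measurable_add measurable_compose[OF measurable_fst F'] measurable_compose[OF measurable_snd assms(3)])
      then show "(\<lambda>(x, \<omega>). indicator A (F (fst x) (snd x) + v \<omega>)) \<in> borel_measurable ((restrict_space borel Z \<Otimes>\<^sub>M restrict_space borel Z) \<Otimes>\<^sub>M M)"
        unfolding split_beta' by (rule measurable_compose) simp
    qed
    moreover have "states m \<Otimes>\<^sub>M actions m = restrict_space borel Z \<Otimes>\<^sub>M restrict_space borel Z"
      by (simp add: m additive_noise_mdp_def)
    ultimately show ?thesis by (simp only: eq)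
  qed
qed

lemma transition_approx_mdp:
  assumes tr: "(\<lambda>(z, a). transition m z a) \<in> states m \<Otimes>\<^sub>M actions m \<rightarrow>\<^sub>M prob_algebra (states m)"
   and Q[measurable]: "Q \<in> states m \<rightarrow>\<^sub>M count_space Y" and Y: "finite Y"
   and nu: "\<nu> \<in> space (prob_algebra (states m))"
   and pos: "\<And>y. y \<in> Y \<Longrightarrow> emeasure \<nu> (cell m Q y) > 0"
  shows "(\<lambda>(z, a). transition (approx_mdp m Y Q \<nu>) z a) \<in> states (approx_mdp m Y Q \<nu>) \<Otimes>\<^sub>M actions (approx_mdp m Y Q \<nu>) \<rightarrow>\<^sub>M prob_algebra (states (approx_mdp m Y Q \<nu>))"
proof -
  define p where "p y a y' = (\<integral>\<^sup>+z. emeasure (transition m z a) (cell m Q y') \<partial>uniform_measure \<nu> (cell m Q y))" for y a y'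
  interpret nu: prob_space \<nu> using nu by (simp add: space_prob_algebra)
  have snu[measurable_cong]: "sets \<nu> = sets (states m)" using nu by (simp add: space_prob_algebra)
  have [measurable]: "cell m Q y \<in> sets (states m)" if "y \<in> Y" for y
    using measurable_sets[OF Q, of "{y}"] that by (simp add: cell_def vimage_def Int_def conj_commute)
  have em[measurable]: "(\<lambda>(z, a). emeasure (transition m z a) (cell m Q y')) \<in> borel_measurable (states m \<Otimes>\<^sub>M actions m)" if "y' \<in> Y" for y'
    using measurable_emeasure_kernel[OF measurable_prob_algebraD[OF tr]] that by (simp add: split_beta')
  have un: "prob_space (uniform_measure \<nu> (cell m Q y))" if "y \<in> Y" for y
    using pos[OF that] by (intro prob_space_uniform_measure) auto
  have pm: "(\<lambda>a. p y a y') \<in> borel_measurable (actions m)" if "y \<in> Y" "y' \<in> Y" for y y'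
  proof -
    interpret u: prob_space "uniform_measure \<nu> (cell m Q y)" by (rule un) fact
    have "(\<lambda>(a, z). emeasure (transition m z a) (cell m Q y')) \<in> borel_measurable (actions m \<Otimes>\<^sub>M uniform_measure \<nu> (cell m Q y))"
      using measurable_compose[OF measurable_pair_swap' em[OF that(2)]] by (simp add: split_beta' measurable_cong_sets[OF sets_pair_measure_cong[OF refl snu]])
    then show ?thesis unfolding p_def by (rule u.borel_measurable_nn_integral)
  qed
  have p1: "(\<Sum>y'\<in>Y. p y a y') = 1" if "y \<in> Y" "a \<in> space (actions m)" for y a
  proof -
    interpret u: prob_space "uniform_measure \<nu> (cell m Q y)" by (rule un) fact
    have me: "(\<lambda>z. emeasure (transition m z a) (cell m Q y')) \<in> borel_measurable (uniform_measure \<nu> (cell m Q y))" if "y' \<in> Y" for y'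
      using measurable_compose[OF measurable_Pair1'[OF \<open>a \<in> _\<close>, of _] measurable_compose[OF measurable_pair_swap' em[OF that]]]
      by (simp add: split_beta' snu cong: measurable_cong_sets)
    have "(\<Sum>y'\<in>Y. p y a y') = (\<integral>\<^sup>+z. (\<Sum>y'\<in>Y. emeasure (transition m z a) (cell m Q y')) \<partial>uniform_measure \<nu> (cell m Q y))"
      unfolding p_def by (rule nn_integral_sum[symmetric]) (rule me)
    also have "\<dots> = (\<integral>\<^sup>+z. 1 \<partial>uniform_measure \<nu> (cell m Q y))"
    proof (rule nn_integral_cong)
      fix z assume "z \<in> space (uniform_measure \<nu> (cell m Q y))"
      then have z: "z \<in> space (states m)" using sets_eq_imp_space_eq[OF snu] by simp
      then have T: "transition m z a \<in> space (prob_algebra (states m))" using measurable_space[OF tr, of "(z,a)"] that by (simp add: space_pair_measure)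
      then have sT: "sets (transition m z a) = sets (states m)" and pT: "prob_space (transition m z a)" by (auto simp: space_prob_algebra)
      have "(\<Sum>y'\<in>Y. emeasure (transition m z a) (cell m Q y')) = emeasure (transition m z a) (\<Union>y'\<in>Y. cell m Q y')"
        using Y by (intro sum_emeasure) (auto simp: sT disjoint_family_on_def cell_def)
      also have "(\<Union>y'\<in>Y. cell m Q y') = space (transition m z a)"
        using measurable_space[OF Q] sets_eq_imp_space_eq[OF sT] by (auto simp: cell_def)
      finally show "(\<Sum>y'\<in>Y. emeasure (transition m z a) (cell m Q y')) = 1" using prob_space.emeasure_space_1[OF pT] by simp
    qed
    finally show ?thesis using u.emeasure_space_1 by simp
  qed
  show ?thesis
  proof (rule measurable_prob_algebra_generated[where G="Pow Y" and \<Omega>=Y])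
    show "sets (states (approx_mdp m Y Q \<nu>)) = sigma_sets Y (Pow Y)"
      using sets.sigma_sets_eq[of "count_space Y"] by (simp add: approx_mdp_def)
    show "Int_stable (Pow Y)" by (auto simp: Int_stable_def)
    show "prob_space ((\<lambda>(z, a). transition (approx_mdp m Y Q \<nu>) z a) x)" if "x \<in> space (states (approx_mdp m Y Q \<nu>) \<Otimes>\<^sub>M actions (approx_mdp m Y Q \<nu>))" for x
      using that by (auto simp: approx_mdp_def space_pair_measure space_point_measure emeasure_point_measure_finite Y p1[unfolded p_def] intro!: prob_spaceI)
    show "sets ((\<lambda>(z, a). transition (approx_mdp m Y Q \<nu>) z a) x) = sets (states (approx_mdp m Y Q \<nu>))" for x
      by (auto simp: approx_mdp_def sets_point_measure split: prod.split)
    show "(\<lambda>x. emeasure ((\<lambda>(z, a). transition (approx_mdp m Y Q \<nu>) z a) x) A) \<in> borel_measurable (states (approx_mdp m Y Q \<nu>) \<Otimes>\<^sub>M actions (approx_mdp m Y Q \<nu>))"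
      if A: "A \<in> Pow Y" for A
    proof -
      have "(\<lambda>x. \<Sum>y'\<in>A. p (fst x) (snd x) y') \<in> borel_measurable (count_space Y \<Otimes>\<^sub>M actions m)"
        using A pm Y by (intro borel_measurable_sum measurable_pair_measure_countable1) (auto intro: countable_finite)
      then show ?thesis using A Y
        by (simp add: approx_mdp_def emeasure_point_measure_finite p_def split_beta')
    qed
  qed simp
qed

text \<open>Under a stationary policy, \<open>path_measure\<close> is the law of the controlled system
  driven by i.i.d. noise that is independent of the initial state.\<close>

primrec closed_loop :: "('e::plus \<Rightarrow> 'e \<Rightarrow> 'e) \<Rightarrow> ('e \<Rightarrow> 'e) \<Rightarrow> 'e \<Rightarrow> (nat \<Rightarrow> 'e) \<Rightarrow> nat \<Rightarrow> 'e" where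
  "closed_loop F f z w 0 = z"
| "closed_loop F f z w (Suc t) = F (closed_loop F f z w t) (f (closed_loop F f z w t)) + w t"

lemma path_measure_closed_loop:
  fixes F :: "'e::euclidean_space \<Rightarrow> 'e \<Rightarrow> 'e" and z0 :: "'w \<Rightarrow> 'e" and v :: "nat \<Rightarrow> 'w \<Rightarrow> 'e"
  assumes Fm: "(\<lambda>(z, a). F z a) \<in> borel_measurable (borel \<Otimes>\<^sub>M borel)"
    and M: "prob_space M"
    and ind: "prob_space.indep_vars M (\<lambda>_. borel) (case_nat z0 v) UNIV"
    and ident: "\<And>t. distr M borel (v t) = distr M borel (v 0)"
    and v_V: "\<And>t \<omega>. \<omega> \<in> space M \<Longrightarrow> v t \<omega> \<in> V"
    and z0_Z: "\<And>\<omega>. \<omega> \<in> space M \<Longrightarrow> z0 \<omega> \<in> Z"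
    and Z: "compact Z"
    and inv: "\<And>z a x. z \<in> Z \<Longrightarrow> a \<in> Z \<Longrightarrow> x \<in> V \<Longrightarrow> F z a + x \<in> Z"
    and m: "m = additive_noise_mdp Z F M (v 0)"
    and f: "f \<in> states m \<rightarrow>\<^sub>M actions m"
  shows "path_measure m (distr M (states m) z0) (stationary m f) =
    distr M (PiM UNIV (\<lambda>_. state_action_space m))
      (\<lambda>\<omega> t. let z = closed_loop F f (z0 \<omega>) (\<lambda>s. v s \<omega>) t in (z, f z))"
proof -
  interpret prob_space M by fact
  define S where "S = restrict_space (borel::'e measure) Z"
  have st: "states m = S" "actions m = S" by (auto simp: m additive_noise_mdp_def S_def)
  have fS[measurable]: "f \<in> S \<rightarrow>\<^sub>M S" using f by (simp add: st)
  have spS: "space S = Z" by (simp add: S_def space_restrict_space)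
  have Zb[measurable]: "Z \<in> sets borel" using Z by (auto dest: compact_imp_closed)
  have idS: "(\<lambda>x. x) \<in> S \<rightarrow>\<^sub>M borel" by (simp add: S_def measurable_restrict_space1)
  have toS: "g \<in> N \<rightarrow>\<^sub>M S" if "g \<in> N \<rightarrow>\<^sub>M borel" "\<And>x. x \<in> space N \<Longrightarrow> g x \<in> Z" for g and N :: "'x measure"
    unfolding S_def using that by (intro measurable_restrict_space2) auto
  obtain \<omega>0 where "\<omega>0 \<in> space M" using not_empty by auto
  then have c: "z0 \<omega>0 \<in> Z" using z0_Z by auto
  define clip where "clip w = (if w \<in> Z then w else z0 \<omega>0)" for w
  have clip[measurable]: "clip \<in> borel \<rightarrow>\<^sub>M S"
    unfolding S_def
  proof (intro measurable_restrict_space2)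
    show "clip \<in> borel_measurable borel" unfolding clip_def[abs_def] by measurable
  qed (auto simp: clip_def c)
  have clip_Z: "clip w \<in> Z" for w by (simp add: clip_def c)
  define Y where "Y = case_nat z0 v"
  have Y[measurable]: "Y i \<in> borel_measurable M" for i
    using ind by (auto simp: indep_vars_def Y_def)
  have z0[measurable]: "z0 \<in> borel_measurable M" using Y[of 0] by (simp add: Y_def)
  have v[measurable]: "v t \<in> borel_measurable M" for t using Y[of "Suc t"] by (simp add: Y_def)
  have FS[measurable]: "(\<lambda>q. F (fst q) (snd q)) \<in> borel_measurable (S \<Otimes>\<^sub>M S)"
    using measurable_compose[OF measurable_Pair[OF measurable_compose[OF measurable_fst idS] measurable_compose[OF measurable_snd idS]] Fm]
    by (simp add: split_beta')
  have FS'[measurable]: "(\<lambda>z. F z (f z)) \<in> borel_measurable S"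
    using measurable_compose[of "\<lambda>z. (z, f z)" S "S \<Otimes>\<^sub>M S", OF _ FS] by simp
  define x where "x t \<omega> = closed_loop F f (z0 \<omega>) (\<lambda>s. v s \<omega>) t" for t \<omega>
  have fZ: "f z \<in> Z" if "z \<in> Z" for z using measurable_space[OF fS] that by (simp add: spS)
  have x_Z: "x t \<omega> \<in> Z" if "\<omega> \<in> space M" for t \<omega>
    by (induction t) (auto simp: x_def that z0_Z v_V inv fZ)
  have x[measurable]: "x t \<in> M \<rightarrow>\<^sub>M S" for t
  proof (induction t)
    case 0 show ?case by (rule toS) (auto simp: x_def[abs_def] z0_Z)
  next
    case (Suc t)
    note [measurable] = Suc
    have "(\<lambda>\<omega>. F (x t \<omega>) (f (x t \<omega>)) + v t \<omega>) \<in> borel_measurable M"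
      using measurable_compose[OF Suc FS'] by simp
    then have "x (Suc t) \<in> borel_measurable M" by (simp add: x_def[abs_def])
    then show ?case by (rule toS) (rule x_Z)
  qed
  define \<phi> where "\<phi> = rec_nat (\<lambda>y. clip (y 0)) (\<lambda>k r y. clip (F (r y) (f (r y)) + y (Suc k)))"
  have \<phi>0: "\<phi> 0 y = clip (y 0)" and \<phi>S: "\<phi> (Suc k) y = clip (F (\<phi> k y) (f (\<phi> k y)) + y (Suc k))" for y :: "nat \<Rightarrow> 'e" and k
    by (auto simp: \<phi>_def)
  have \<phi>m: "\<phi> k \<in> PiM {..n} (\<lambda>_. borel) \<rightarrow>\<^sub>M S" if "k \<le> n" for k n
    using that
  proof (induction k)
    case 0
    have co: "(\<lambda>y. y 0) \<in> borel_measurable (PiM {..n} (\<lambda>_. borel))"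
      by (intro measurable_component_singleton) auto
    have "\<phi> 0 = (\<lambda>y. clip (y 0))" by (auto simp: \<phi>0)
    then show ?case using measurable_compose[OF co clip] by simp
  next
    case (Suc k)
    then have IH: "\<phi> k \<in> PiM {..n} (\<lambda>_. borel) \<rightarrow>\<^sub>M S" by simp
    have co: "(\<lambda>y. y (Suc k)) \<in> borel_measurable (PiM {..n} (\<lambda>_. borel))"
      using Suc.prems by (intro measurable_component_singleton) auto
    have "\<phi> (Suc k) = (\<lambda>y. clip (F (\<phi> k y) (f (\<phi> k y)) + y (Suc k)))" by (auto simp: \<phi>S)
    then show ?case
      using measurable_compose[OF borel_measurable_add[OF measurable_compose[OF IH FS'] co] clip] by simp
  qed
  have x\<phi>: "x k \<omega> = \<phi> k (\<lambda>i\<in>{..n}. Y i \<omega>)" if "\<omega> \<in> space M" "k \<le> n" for k n \<omega>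
    using \<open>k \<le> n\<close>
  proof (induction k)
    case 0 show ?case using z0_Z[OF that(1)] by (simp add: x_def \<phi>0 Y_def clip_def)
  next
    case (Suc k) 
    have e: "x (Suc k) \<omega> = F (x k \<omega>) (f (x k \<omega>)) + v k \<omega>" by (simp add: x_def)
    have ce: "clip (F (x k \<omega>) (f (x k \<omega>)) + v k \<omega>) = F (x k \<omega>) (f (x k \<omega>)) + v k \<omega>"
      using x_Z[OF that(1), of "Suc k"] by (simp add: clip_def e)
    have IH: "\<phi> k (\<lambda>i\<in>{..n}. Y i \<omega>) = x k \<omega>" using Suc.IH Suc.prems by (metis Suc_leD)
    have "(\<lambda>i\<in>{..n}. Y i \<omega>) (Suc k) = v k \<omega>" using Suc.prems by (simp add: Y_def)
    then show ?case unfolding \<phi>S IH by (simp only: ce e)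
  qed
  define SA where "SA = S \<Otimes>\<^sub>M S"
  define X where "X t \<omega> = (x t \<omega>, f (x t \<omega>))" for t \<omega>
  have X[measurable]: "X t \<in> M \<rightarrow>\<^sub>M SA" for t unfolding X_def SA_def by measurable
  define H where "H n \<omega> = (\<lambda>t\<in>{0..<n}. X t \<omega>)" for n \<omega>
  have H[measurable]: "H n \<in> M \<rightarrow>\<^sub>M PiM {0..<n} (\<lambda>_. SA)" for n unfolding H_def by measurable
  define D where "D = distr M borel (v 0)"
  interpret D: prob_space D unfolding D_def by (rule prob_space_distr) simp
  have sD[measurable_cong]: "sets D = sets borel" by (simp add: D_def)
  have joint: "distr M (PiM {0..<Suc k} (\<lambda>_. SA) \<Otimes>\<^sub>M borel) (\<lambda>\<omega>. (H (Suc k) \<omega>, v k \<omega>)) =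
     distr M (PiM {0..<Suc k} (\<lambda>_. SA)) (H (Suc k)) \<Otimes>\<^sub>M D" for k
  proof -
    define h where "h y = (\<lambda>t\<in>{0..<Suc k}. (\<phi> t y, f (\<phi> t y)))" for y
    let ?N = "PiM {0..<Suc k} (\<lambda>_. SA)"
    let ?A = "PiM {..k} (\<lambda>_. borel :: 'e measure)" and ?B = "PiM {Suc k} (\<lambda>_. borel :: 'e measure)"
    let ?X = "\<lambda>\<omega>. \<lambda>i\<in>{..k}. Y i \<omega>" and ?Y = "\<lambda>\<omega>. \<lambda>i\<in>{Suc k}. Y i \<omega>"
    have "indep_var ?A ?X ?B ?Y"
      using ind unfolding Y_def[symmetric] by (rule indep_var_restrict) auto
    then have eq: "distr M ?A ?X \<Otimes>\<^sub>M distr M ?B ?Y = distr M (?A \<Otimes>\<^sub>M ?B) (\<lambda>\<omega>. (?X \<omega>, ?Y \<omega>))"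
      and XY: "?X \<in> M \<rightarrow>\<^sub>M ?A" "?Y \<in> M \<rightarrow>\<^sub>M ?B"
      by (auto simp: indep_var_distribution_eq)
    have hm: "h \<in> ?A \<rightarrow>\<^sub>M ?N"
      unfolding h_def SA_def
      by (intro measurable_restrict measurable_Pair \<phi>m measurable_compose[OF \<phi>m fS]) auto
    have pm: "(\<lambda>y. y (Suc k)) \<in> ?B \<rightarrow>\<^sub>M (borel :: 'e measure)"
      by (intro measurable_component_singleton) auto
    have d1: "distr (distr M ?A ?X) ?N h = distr M ?N (H (Suc k))"
    proof -
      have "distr (distr M ?A ?X) ?N h = distr M ?N (h \<circ> ?X)"
        by (rule distr_distr[OF hm XY(1)])
      also have "\<dots> = distr M ?N (H (Suc k))"
      proof (intro distr_cong refl)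
        fix \<omega> assume "\<omega> \<in> space M"
        then show "(h \<circ> ?X) \<omega> = H (Suc k) \<omega>"
          unfolding h_def H_def X_def comp_def by (intro restrict_ext) (simp only: x\<phi>[symmetric] atLeastLessThan_iff less_Suc_eq_le)
      qed
      finally show ?thesis .
    qed
    have d2: "distr (distr M ?B ?Y) borel (\<lambda>y. y (Suc k)) = D"
      using ident[of k] by (subst distr_distr[OF pm XY(2)]) (simp add: comp_def D_def Y_def)
    have "distr M ?N (H (Suc k)) \<Otimes>\<^sub>M D =
       distr (distr M ?A ?X \<Otimes>\<^sub>M distr M ?B ?Y) (?N \<Otimes>\<^sub>M borel) (\<lambda>(y, y'). (h y, y' (Suc k)))"
      unfolding d1[symmetric] d2[symmetric]
    proof (rule pair_measure_distr)
      show "sigma_finite_measure (distr (distr M ?B ?Y) borel (\<lambda>y. y (Suc k)))"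
        unfolding d2 by (rule D.sigma_finite_measure_axioms)
    qed (use hm pm in simp_all)
    also have "\<dots> = distr M (?N \<Otimes>\<^sub>M borel) ((\<lambda>(y, y'). (h y, y' (Suc k))) \<circ> (\<lambda>\<omega>. (?X \<omega>, ?Y \<omega>)))"
      unfolding eq using XY hm pm
      by (intro distr_distr) (auto simp: split_beta' intro!: measurable_Pair measurable_compose[OF measurable_fst hm] measurable_compose[OF measurable_snd pm])
    also have "\<dots> = distr M (?N \<Otimes>\<^sub>M borel) (\<lambda>\<omega>. (H (Suc k) \<omega>, v k \<omega>))"
    proof (intro distr_cong refl)
      fix \<omega> assume "\<omega> \<in> space M"
      then have "h (?X \<omega>) = H (Suc k) \<omega>"
        unfolding h_def H_def X_def by (intro restrict_ext) (simp only: x\<phi>[symmetric] atLeastLessThan_iff less_Suc_eq_le)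
      then show "((\<lambda>(y, y'). (h y, y' (Suc k))) \<circ> (\<lambda>\<omega>. (?X \<omega>, ?Y \<omega>))) \<omega> = (H (Suc k) \<omega>, v k \<omega>)"
        by (simp add: Y_def)
    qed
    finally show ?thesis ..
  qed
  define K where "K = stage_kernel m (distr M (states m) z0) (stationary m f)"
  have bind_det: "N \<bind> (\<lambda>z. stationary m f n (h, z) \<bind> (\<lambda>a. return (state_action_space m) (z, a))) = distr N SA (\<lambda>z. (z, f z))"
    if "sets N = sets S" for N n h
  proof -
    have spN: "space N = Z" using sets_eq_imp_space_eq[OF that] by (simp add: spS)
    have "N \<bind> (\<lambda>z. stationary m f n (h, z) \<bind> (\<lambda>a. return (state_action_space m) (z, a))) = N \<bind> (\<lambda>z. return SA (z, f z))"
    proof (intro bind_cong refl)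
      fix z assume "z \<in> space N"
      then have z: "z \<in> Z" by (simp add: spN)
      have "(\<lambda>a. return SA (z, a)) \<in> S \<rightarrow>\<^sub>M subprob_algebra SA"
        by (rule measurable_compose[OF _ return_measurable]) (use z in \<open>simp add: SA_def spS\<close>)
      from bind_return[OF this] z fZ show "stationary m f n (h, z) \<bind> (\<lambda>a. return (state_action_space m) (z, a)) = return SA (z, f z)"
        by (simp add: stationary_def st SA_def spS)
    qed
    also have "\<dots> = distr N SA (\<lambda>z. (z, f z))"
      using c spN by (intro bind_return_distr') (auto simp: SA_def that cong: measurable_cong_sets)
    finally show ?thesis .
  qed
  have K0: "K 0 h = distr M SA (X 0)" for h
  proof -
    have z0S: "z0 \<in> M \<rightarrow>\<^sub>M S" by (rule toS) (auto simp: z0_Z)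
    have "sets (distr M (states m) z0) = sets S" by (simp add: st)
    from bind_det[OF this, of 0 h] have "K 0 h = distr (distr M S z0) SA (\<lambda>z. (z, f z))"
      unfolding K_def stage_kernel_def by (simp add: st)
    also have "\<dots> = distr M SA (X 0)"
      by (subst distr_distr[OF _ z0S]) (auto simp: SA_def X_def[abs_def] x_def comp_def)
    finally show ?thesis .
  qed
  have KS: "K (Suc k) h = distr D SA (\<lambda>w. (clip (F (fst (h k)) (snd (h k)) + w), f (clip (F (fst (h k)) (snd (h k)) + w))))"
    if "h k \<in> space SA" for k h
  proof -
    define z a where "z = fst (h k)" and "a = snd (h k)"
    have hk: "h k = (z, a)" "z \<in> Z" "a \<in> Z" using that by (auto simp: SA_def space_pair_measure spS z_def a_def)
    have "restrict_space (distr M borel (\<lambda>\<omega>. F z a + v 0 \<omega>)) Z = distr D S (\<lambda>w. clip (F z a + w))"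
    proof (rule measure_eqI)
      show "sets (restrict_space (distr M borel (\<lambda>\<omega>. F z a + v 0 \<omega>)) Z) = sets (distr D S (\<lambda>w. clip (F z a + w)))"
        by (simp add: S_def sets_restrict_space)
      fix A assume "A \<in> sets (restrict_space (distr M borel (\<lambda>\<omega>. F z a + v 0 \<omega>)) Z)"
      then have A: "A \<in> sets borel" "A \<subseteq> Z" "A \<in> sets S" by (auto simp: sets_restrict_space S_def)
      have "emeasure (restrict_space (distr M borel (\<lambda>\<omega>. F z a + v 0 \<omega>)) Z) A = emeasure M ((\<lambda>\<omega>. F z a + v 0 \<omega>) -` A \<inter> space M)"
        using A by (simp add: emeasure_restrict_space emeasure_distr)
      also have "(\<lambda>\<omega>. F z a + v 0 \<omega>) -` A \<inter> space M = v 0 -` ((\<lambda>w. clip (F z a + w)) -` A \<inter> space D) \<inter> space M"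
        using inv[OF hk(2,3) v_V] by (auto simp: clip_def D_def)
      also have "emeasure M \<dots> = emeasure D ((\<lambda>w. clip (F z a + w)) -` A \<inter> space D)"
      proof -
        have "(\<lambda>w. clip (F z a + w)) -` A \<inter> space D \<in> sets borel"
          using measurable_sets[of "\<lambda>w. clip (F z a + w)" D S A] A(3) by (simp add: sD)
        then show ?thesis unfolding D_def by (subst emeasure_distr) auto
      qed
      also have "\<dots> = emeasure (distr D S (\<lambda>w. clip (F z a + w))) A"
        using A by (subst emeasure_distr) auto
      finally show "emeasure (restrict_space (distr M borel (\<lambda>\<omega>. F z a + v 0 \<omega>)) Z) A = emeasure (distr D S (\<lambda>w. clip (F z a + w))) A" .
    qed
    then have tm: "transition m z a = distr D S (\<lambda>w. clip (F z a + w))" by (simp add: m additive_noise_mdp_def)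
    then have "sets (transition m z a) = sets S" by simp
    from bind_det[OF this, of "Suc k" h] have "K (Suc k) h = distr (transition m z a) SA (\<lambda>z. (z, f z))"
      unfolding K_def stage_kernel_def by (simp add: hk)
    also have "\<dots> = distr (distr D S (\<lambda>w. clip (F z a + w))) SA (\<lambda>z. (z, f z))" by (simp only: tm)
    also have "\<dots> = distr D SA (\<lambda>w. (clip (F z a + w), f (clip (F z a + w))))"
      by (subst distr_distr) (auto simp: SA_def comp_def)
    finally show ?thesis by (simp add: hk)
  qed
  have tr: "(\<lambda>(z, a). transition m z a) \<in> states m \<Otimes>\<^sub>M actions m \<rightarrow>\<^sub>M prob_algebra (states m)"
    using Fm M v[of 0] _ Z inv m by (rule transition_additive_noise) (auto simp: v_V)
  have "distr M (states m) z0 \<in> space (prob_algebra (states m))"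
    by (auto simp: space_prob_algebra st intro!: prob_space_distr toS z0_Z)
  then interpret IT: Ionescu_Tulcea K "\<lambda>_. SA"
    using Ionescu_Tulcea_stage_kernel[OF tr _ stationary_in_policies[OF f]] by (simp add: K_def SA_def st)
  have C: "IT.C 0 n (\<lambda>_. undefined) = distr M (PiM {0..<n} (\<lambda>_. SA)) (H n)" for n
  proof (induction n)
    case 0
    have "H 0 \<omega> = (\<lambda>_. undefined)" for \<omega> by (auto simp: H_def)
    then have "H 0 = (\<lambda>\<omega>. (\<lambda>_. undefined))" by auto
    then show ?case by (simp add: space_PiM)
  next
    case (Suc n)
    have spH: "H n \<omega> \<in> space (PiM {0..<n} (\<lambda>_. SA))" if "\<omega> \<in> space M" for \<omega> using measurable_space[OF H that] .
    have Hup: "(H n \<omega>)(n := X n \<omega>) = H (Suc n) \<omega>" for \<omega> by (auto simp: H_def)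
    show ?case
    proof (rule measure_eqI)
      show "sets (IT.C 0 (Suc n) (\<lambda>_. undefined)) = sets (distr M (PiM {0..<Suc n} (\<lambda>_. SA)) (H (Suc n)))"
        using IT.sets_C[of "\<lambda>_. undefined" 0 "Suc n"] by (simp add: space_PiM)
      fix A assume "A \<in> sets (IT.C 0 (Suc n) (\<lambda>_. undefined))"
      then have A[measurable]: "A \<in> sets (PiM {0..<Suc n} (\<lambda>_. SA))"
        using IT.sets_C[of "\<lambda>_. undefined" 0 "Suc n"] by (simp add: space_PiM)
      have "emeasure (IT.C 0 (Suc n) (\<lambda>_. undefined)) A = (\<integral>\<^sup>+h. emeasure (IT.eP n h) A \<partial>distr M (PiM {0..<n} (\<lambda>_. SA)) (H n))"
        using not_empty by (simp add: Suc) (subst emeasure_bind[OF _ _ A], auto simp: space_PiM_empty_iff intro!: IT.measurable_eP)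
      also have "\<dots> = (\<integral>\<^sup>+\<omega>. emeasure (IT.eP n (H n \<omega>)) A \<partial>M)"
        by (subst nn_integral_distr) auto
      also have "\<dots> = (\<integral>\<^sup>+\<omega>. (\<integral>\<^sup>+q. indicator A ((H n \<omega>)(n := q)) \<partial>K n (H n \<omega>)) \<partial>M)"
      proof (rule nn_integral_cong)
        fix \<omega> assume "\<omega> \<in> space M"
        from IT.nn_integral_eP[OF spH[OF this], of "indicator A"] IT.sets_eP[OF spH[OF this]]
        show "emeasure (IT.eP n (H n \<omega>)) A = (\<integral>\<^sup>+q. indicator A ((H n \<omega>)(n := q)) \<partial>K n (H n \<omega>))" by simp
      qed
      also have "\<dots> = (\<integral>\<^sup>+\<omega>. indicator A (H (Suc n) \<omega>) \<partial>M)"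
      proof (cases n)
        case 0
        have H0: "H 0 \<omega> = (\<lambda>_. undefined)" for \<omega> by (auto simp: H_def)
        have ms: "(\<lambda>q. (\<lambda>_. undefined)(0 := q)) \<in> SA \<rightarrow>\<^sub>M PiM {0..<Suc 0} (\<lambda>_. SA)"
          by (rule measurable_fun_upd[where J="{}"]) (auto simp: space_PiM)
        have "(\<integral>\<^sup>+q. indicator A ((H 0 \<omega>)(0 := q)) \<partial>K 0 (H 0 \<omega>)) = (\<integral>\<^sup>+\<omega>'. indicator A (H (Suc 0) \<omega>') \<partial>M)" for \<omega>
          unfolding K0 H0 using A ms Hup[unfolded 0] H0
          by (subst nn_integral_distr) (auto simp: 0 intro!: measurable_compose[OF ms] nn_integral_cong)
        then show ?thesis using 0 emeasure_space_1 by simp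
      next
        case (Suc k)
        define G where "G = (\<lambda>(h :: nat \<Rightarrow> 'e \<times> 'e, w). h(n := (clip (F (fst (h k)) (snd (h k)) + w), f (clip (F (fst (h k)) (snd (h k)) + w)))))"
        have hk: "(\<lambda>p. fst p k) \<in> PiM {0..<n} (\<lambda>_. SA) \<Otimes>\<^sub>M borel \<rightarrow>\<^sub>M S \<Otimes>\<^sub>M S"
          using measurable_compose[OF measurable_fst, of "\<lambda>h. h k" "PiM {0..<n} (\<lambda>_. SA)" SA] measurable_component_singleton[of k "{0..<n}" "\<lambda>_. SA"] Suc by (simp add: SA_def)
        have cl: "(\<lambda>p. clip (F (fst (fst p k)) (snd (fst p k)) + snd p)) \<in> PiM {0..<n} (\<lambda>_. SA) \<Otimes>\<^sub>M borel \<rightarrow>\<^sub>M S"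
          by (intro measurable_compose[OF borel_measurable_add[OF measurable_compose[OF hk FS] measurable_snd] clip])
        have G[measurable]: "G \<in> PiM {0..<n} (\<lambda>_. SA) \<Otimes>\<^sub>M borel \<rightarrow>\<^sub>M PiM {0..<Suc n} (\<lambda>_. SA)"
          unfolding G_def split_beta'
          by (rule measurable_fun_upd[where J="{0..<n}"])
             (auto simp: SA_def intro!: measurable_Pair cl[unfolded SA_def] measurable_compose[OF cl fS, unfolded SA_def])
        have "(\<integral>\<^sup>+\<omega>. (\<integral>\<^sup>+q. indicator A ((H n \<omega>)(n := q)) \<partial>K n (H n \<omega>)) \<partial>M) = (\<integral>\<^sup>+\<omega>. (\<integral>\<^sup>+w. indicator A (G (H n \<omega>, w)) \<partial>D) \<partial>M)"
        proof (rule nn_integral_cong)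
          fix \<omega> assume \<omega>: "\<omega> \<in> space M"
          have hS: "H n \<omega> k \<in> space SA" using measurable_space[OF X \<omega>] Suc by (simp add: H_def)
          then have hS': "H (Suc k) \<omega> k \<in> space SA" using Suc by simp
          have hF: "(\<lambda>w. clip (F (fst (H n \<omega> k)) (snd (H n \<omega> k)) + w)) \<in> borel \<rightarrow>\<^sub>M S" by measurable
          have ms: "(\<lambda>q. (H n \<omega>)(n := q)) \<in> SA \<rightarrow>\<^sub>M PiM {0..<Suc n} (\<lambda>_. SA)"
            using spH[OF \<omega>] by (intro measurable_fun_upd[where J="{0..<n}"]) auto
          have hF2: "(\<lambda>w. (clip (F (fst (H n \<omega> k)) (snd (H n \<omega> k)) + w), f (clip (F (fst (H n \<omega> k)) (snd (H n \<omega> k)) + w)))) \<in> D \<rightarrow>\<^sub>M SA"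
            unfolding SA_def by (intro measurable_Pair hF measurable_compose[OF hF fS] | simp add: sD hF measurable_compose[OF hF fS] cong: measurable_cong_sets)+
          have KK: "K n (H n \<omega>) = distr D SA (\<lambda>w. (clip (F (fst (H n \<omega> k)) (snd (H n \<omega> k)) + w), f (clip (F (fst (H n \<omega> k)) (snd (H n \<omega> k)) + w))))"
            using KS[of "H (Suc k) \<omega>" k] hS' Suc by simp
          show "(\<integral>\<^sup>+q. indicator A ((H n \<omega>)(n := q)) \<partial>K n (H n \<omega>)) = (\<integral>\<^sup>+w. indicator A (G (H n \<omega>, w)) \<partial>D)"
            unfolding KK using measurable_compose[OF ms borel_measurable_indicator[OF A]]
            by (subst nn_integral_distr[OF hF2]) (auto simp: G_def)
        qed
        also have "\<dots> = (\<integral>\<^sup>+h. (\<integral>\<^sup>+w. indicator A (G (h, w)) \<partial>D) \<partial>distr M (PiM {0..<n} (\<lambda>_. SA)) (H n))"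
          by (subst nn_integral_distr) (auto intro!: D.borel_measurable_nn_integral)
        also have "\<dots> = (\<integral>\<^sup>+p. indicator A (G p) \<partial>(distr M (PiM {0..<n} (\<lambda>_. SA)) (H n) \<Otimes>\<^sub>M D))"
          by (subst D.nn_integral_fst[symmetric]) auto
        also have "\<dots> = (\<integral>\<^sup>+p. indicator A (G p) \<partial>distr M (PiM {0..<n} (\<lambda>_. SA) \<Otimes>\<^sub>M borel) (\<lambda>\<omega>. (H n \<omega>, v k \<omega>)))"
          using joint[of k] Suc by simp
        also have "\<dots> = (\<integral>\<^sup>+\<omega>. indicator A (G (H n \<omega>, v k \<omega>)) \<partial>M)"
          by (subst nn_integral_distr) auto
        also have "\<dots> = (\<integral>\<^sup>+\<omega>. indicator A (H (Suc n) \<omega>) \<partial>M)"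
        proof (rule nn_integral_cong)
          fix \<omega> assume \<omega>: "\<omega> \<in> space M"
          have "clip (F (x k \<omega>) (f (x k \<omega>)) + v k \<omega>) = x n \<omega>"
            using x_Z[OF \<omega>, of n] Suc by (simp add: x_def clip_def)
          then have "G (H n \<omega>, v k \<omega>) = H (Suc n) \<omega>"
            using Hup[of \<omega>] Suc by (simp add: G_def H_def X_def)
          then show "indicator A (G (H n \<omega>, v k \<omega>)) = (indicator A (H (Suc n) \<omega>) :: ennreal)" by simp
        qed
        finally show ?thesis .
      qed
      also have "\<dots> = emeasure (distr M (PiM {0..<Suc n} (\<lambda>_. SA)) (H (Suc n))) A"
        by (subst nn_integral_distr[of "H (Suc n)" M "PiM {0..<Suc n} (\<lambda>_. SA)" "indicator A", symmetric]) auto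
      finally show "emeasure (IT.C 0 (Suc n) (\<lambda>_. undefined)) A = emeasure (distr M (PiM {0..<Suc n} (\<lambda>_. SA)) (H (Suc n))) A" .
    qed
  qed
  have XU[measurable]: "(\<lambda>\<omega> t. X t \<omega>) \<in> M \<rightarrow>\<^sub>M PiM UNIV (\<lambda>_. SA)"
    by (rule measurable_PiM_single') (auto dest: measurable_space[OF X])
  have "IT.PF.lim = distr M (PiM UNIV (\<lambda>_. SA)) (\<lambda>\<omega> t. X t \<omega>)"
  proof (rule measure_eqI_PiM_infinite[symmetric])
    show "sets IT.PF.lim = sets (PiM UNIV (\<lambda>_. SA))" by simp
    show "sets (distr M (PiM UNIV (\<lambda>_. SA)) (\<lambda>\<omega> t. X t \<omega>)) = sets (PiM UNIV (\<lambda>_. SA))" by simp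
    show "finite_measure (distr M (PiM UNIV (\<lambda>_. SA)) (\<lambda>\<omega> t. X t \<omega>))"
      using prob_space_distr[OF XU] by (rule prob_space.finite_measure)
    fix A and J :: "nat set" assume J: "finite J" and A: "\<And>i. i \<in> J \<Longrightarrow> A i \<in> sets SA"
    have E: "Pi\<^sub>E J A \<in> sets (PiM J (\<lambda>_. SA))" using J A by (intro sets_PiM_I_finite) auto
    let ?n = "IT.up_to J"
    have Jn: "J \<subseteq> {0..<?n}" using IT.up_to[OF J] .
    have "emeasure IT.PF.lim (prod_emb UNIV (\<lambda>_. SA) J (Pi\<^sub>E J A)) = emeasure (IT.C 0 ?n (\<lambda>_. undefined)) (prod_emb {0..<?n} (\<lambda>_. SA) J (Pi\<^sub>E J A))"
      using IT.lim[OF J E] IT.emeasure_CI'[OF J E] by simp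
    also have "\<dots> = emeasure M (H ?n -` prod_emb {0..<?n} (\<lambda>_. SA) J (Pi\<^sub>E J A) \<inter> space M)"
      unfolding C by (rule emeasure_distr) (auto intro!: measurable_prod_emb Jn E)
    also have "H ?n -` prod_emb {0..<?n} (\<lambda>_. SA) J (Pi\<^sub>E J A) \<inter> space M = (\<lambda>\<omega> t. X t \<omega>) -` prod_emb UNIV (\<lambda>_. SA) J (Pi\<^sub>E J A) \<inter> space M"
      using Jn measurable_space[OF X] by (auto simp: prod_emb_def H_def PiE_iff subset_eq)
    also have "emeasure M \<dots> = emeasure (distr M (PiM UNIV (\<lambda>_. SA)) (\<lambda>\<omega> t. X t \<omega>)) (prod_emb UNIV (\<lambda>_. SA) J (Pi\<^sub>E J A))"
      by (rule emeasure_distr[symmetric]) (auto intro!: measurable_prod_emb E)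
    finally show "emeasure (distr M (PiM UNIV (\<lambda>_. SA)) (\<lambda>\<omega> t. X t \<omega>)) (prod_emb UNIV (\<lambda>_. SA) J (Pi\<^sub>E J A)) = emeasure IT.PF.lim (prod_emb UNIV (\<lambda>_. SA) J (Pi\<^sub>E J A))" ..
  qed
  then show ?thesis
    by (simp add: path_measure_def K_def SA_def st X_def x_def Let_def)
qed

end

(* Under f o Q_n the actions lie in a set Y of at most n points, while every state is a sum x + w of
   independent x and w, where w has density g (x = 0 at time 0). Since the law of w is absolutely
   continuous, there is \<rho> > 0 such that n balls of radius r = \<rho> n^(-1/d) have probability at most
   1/2 for w, wherever their centres are; translating Y by -x, the state is at distance at least r
   from Y with probability at least 1/2. Each stage thus costs at least r/2 on average, and the
   choice L = \<rho>/2 works for both criteria. *)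

theory Submission
  imports Defs
begin

text \<open>The exponent 1/d is volume scaling: n balls of radius r have volume at most n u r^d,
  with u the volume of the unit ball, so r may be of order n^(-1/d) while this total stays below a
  fixed threshold. The threshold depends only on \<open>g\<close>. The level 1/2 is a convenient
  choice; any level below 1 would leave a positive constant. The obstacle lies in the path measure.
  It is built from transition kernels, whereas the argument speaks of a predicted state plus fresh
  noise. Passing from one to the other takes a sample space that carries an initial state with law
  \<open>\<mu>\<close>, independent of the noise, and on which the noise lies in \<open>V\<close> at
  every point. The given space comes with no such initial state, and there the noise is known to lie
  in \<open>V\<close> only almost surely. A new product space is therefore built, so chosen that the
  decision process remains literally the same.\<close>

section \<open>Absolute continuity and unions of small balls\<close>

text \<open>Truncation of the density: the sets where \<open>g\<close> exceeds k decrease to the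
  empty set, so their mass tends to 0, and below level k the mass is at most k times the reference
  measure. Each of the two pieces receives half of \<open>\<epsilon>\<close>.\<close>

lemma density_small_sets:
  assumes g: "g \<in> borel_measurable N" and fin: "finite_measure (density N (\<lambda>x. ennreal (g x)))"
    and \<epsilon>: "\<epsilon> > 0"
  obtains \<delta> where "\<delta> > 0"
    "\<And>U. U \<in> sets N \<Longrightarrow> emeasure N U \<le> ennreal \<delta> \<Longrightarrow> measure (density N (\<lambda>x. ennreal (g x))) U \<le> \<epsilon>"
proof -
  define D where "D = density N (\<lambda>x. ennreal (g x))"
  interpret D: finite_measure D using fin by (simp add: D_def)
  note [measurable] = g
  define A where "A k = {x \<in> space N. g x > real k}" for k
  have A[measurable]: "A k \<in> sets N" for k unfolding A_def by measurable
  have "decseq A" by (auto simp: decseq_def A_def)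
  moreover have "range A \<subseteq> sets D" by (auto simp: D_def)
  ultimately have "(\<lambda>k. measure D (A k)) \<longlonglongrightarrow> measure D (\<Inter>k. A k)"
    by (intro D.finite_Lim_measure_decseq)
  moreover have "(\<Inter>k. A k) = {}"
  proof -
    have "x \<notin> (\<Inter>k. A k)" for x
      using reals_Archimedean2[of "g x"] by (auto simp: A_def not_less intro: less_imp_le)
    then show ?thesis by blast
  qed
  ultimately have "(\<lambda>k. measure D (A k)) \<longlonglongrightarrow> 0" by simp
  then have "eventually (\<lambda>k. measure D (A k) < \<epsilon> / 2) sequentially"
    using \<epsilon> by (intro order_tendstoD) auto
  then obtain k0 where k0: "\<And>k. k \<ge> k0 \<Longrightarrow> measure D (A k) < \<epsilon> / 2"
    by (auto simp: eventually_sequentially)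
  \<comment> \<open>The successor makes k positive, so that \<open>\<epsilon> / (2 * real k)\<close>
    is a genuine threshold.\<close>
  define k where "k = Suc k0"
  have k: "measure D (A k) < \<epsilon> / 2" "k > 0" using k0 by (auto simp: k_def)
  show thesis
  proof (rule that[of "\<epsilon> / (2 * real k)"])
    show "\<epsilon> / (2 * real k) > 0" using \<epsilon> k by simp
    fix U assume U[measurable]: "U \<in> sets N" and le: "emeasure N U \<le> ennreal (\<epsilon> / (2 * real k))"
    have "emeasure D (U - A k) = (\<integral>\<^sup>+x. ennreal (g x) * indicator (U - A k) x \<partial>N)"
      unfolding D_def by (rule emeasure_density) auto
    also have "\<dots> \<le> (\<integral>\<^sup>+x. ennreal (real k) * indicator U x \<partial>N)"
      using sets.sets_into_space[OF U]
      by (intro nn_integral_mono) (auto simp: A_def indicator_def ennreal_leI simp del: ennreal_of_nat_eq_real_of_nat)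
    also have "\<dots> = ennreal (real k) * emeasure N U" by (simp add: nn_integral_cmult_indicator)
    also have "\<dots> \<le> ennreal (real k) * ennreal (\<epsilon> / (2 * real k))" by (intro mult_left_mono le) auto
    also have "\<dots> = ennreal (\<epsilon> / 2)" using k by (simp add: ennreal_mult'[symmetric])
    finally have "measure D (U - A k) \<le> \<epsilon> / 2"
      using \<epsilon> by (simp add: D.emeasure_eq_measure)
    moreover have "measure D U \<le> measure D (U - A k) + measure D (A k)"
    proof -
      have "measure D U \<le> measure D ((U - A k) \<union> A k)"
        by (intro D.finite_measure_mono) (auto simp: D_def)
      also have "\<dots> \<le> measure D (U - A k) + measure D (A k)"
        by (intro measure_Un_le) (auto simp: D_def)
      finally show ?thesis .
    qed
    ultimately show "measure (density N (\<lambda>x. ennreal (g x))) U \<le> \<epsilon>" using k by (simp add: D_def)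
  qed
qed

text \<open>Only volumes enter, and these ignore the centres; hence one \<open>\<rho>\<close> serves
  all \<open>n\<close> and all \<open>Y\<close>.\<close>

lemma density_union_cball:
  fixes g :: "'e::euclidean_space \<Rightarrow> real"
  assumes g: "g \<in> borel_measurable borel"
    and fin: "finite_measure (density lborel (\<lambda>x. ennreal (g x)))" and \<epsilon>: "\<epsilon> > 0"
  obtains \<rho> where "\<rho> > 0"
    "\<And>n Y. n \<ge> 1 \<Longrightarrow> finite Y \<Longrightarrow> card Y \<le> n \<Longrightarrow>
      measure (density lborel (\<lambda>x. ennreal (g x)))
        (\<Union>y\<in>Y. cball y (\<rho> * (1 / real n) powr (1 / real DIM('e)))) \<le> \<epsilon>"
proof -
  let ?d = "DIM('e)"
  let ?u = "unit_ball_vol (real ?d)"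
  obtain \<delta> where \<delta>: "\<delta> > 0"
    "\<And>U. U \<in> sets lborel \<Longrightarrow> emeasure lborel U \<le> ennreal \<delta> \<Longrightarrow> measure (density lborel (\<lambda>x. ennreal (g x))) U \<le> \<epsilon>"
    using density_small_sets[of g lborel \<epsilon>] assms by auto
  have u: "?u > 0" by simp
  then have u0: "?u \<noteq> 0" by (rule less_imp_neq[symmetric])
  \<comment> \<open>The solution of u \<rho>^d = \<delta>: each ball of radius r then has volume
    exactly \<delta>/n.\<close>
  define \<rho> where "\<rho> = (\<delta> / ?u) powr (1 / real ?d)"
  have \<rho>: "\<rho> > 0" using \<delta>(1) u0 by (simp add: \<rho>_def)
  show thesis
  proof (rule that[OF \<rho>])
    fix n :: nat and Y :: "'e set"
    assume n: "n \<ge> 1" and Y: "finite Y" "card Y \<le> n"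
    define r where "r = \<rho> * (1 / real n) powr (1 / real ?d)"
    have r0: "r \<ge> 0" using \<rho> by (simp add: r_def)
    have root: "(a powr (1 / real ?d)) ^ ?d = a" if "a > 0" for a :: real
      using that by (simp add: powr_realpow[symmetric] powr_powr)
    have "r ^ ?d = (\<delta> / ?u) * (1 / real n)"
      unfolding r_def \<rho>_def power_mult_distrib using \<delta>(1) u n by (intro arg_cong2[where f="(*)"] root) (auto intro: divide_pos_pos)
    then have vol: "emeasure lborel (cball y r) = ennreal (\<delta> / real n)" for y :: 'e
      using u0 by (simp add: emeasure_cball[OF r0])
    have "emeasure lborel (\<Union>y\<in>Y. cball y r) \<le> (\<Sum>y\<in>Y. emeasure lborel (cball y r))"
      by (intro emeasure_subadditive_finite Y) auto
    also have "\<dots> = ennreal (real (card Y) * (\<delta> / real n))"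
      using \<delta> by (simp add: vol ennreal_of_nat_eq_real_of_nat ennreal_mult'[symmetric])
    also have "\<dots> \<le> ennreal (real n * (\<delta> / real n))"
      using Y \<delta> by (intro ennreal_leI mult_right_mono) auto
    also have "\<dots> = ennreal \<delta>" using n by simp
    finally have le: "emeasure lborel (\<Union>y\<in>Y. cball y r) \<le> ennreal \<delta>" .
    have "(\<Union>y\<in>Y. cball y r) \<in> sets lborel" using Y by (auto intro!: sets.finite_UN)
    from \<delta>(2)[OF this le]
    show "measure (density lborel (\<lambda>x. ennreal (g x))) (\<Union>y\<in>Y. cball y (\<rho> * (1 / real n) powr (1 / real ?d))) \<le> \<epsilon>"
      by (simp add: r_def)
  qed
qed

section \<open>Closed-loop trajectories and independence of the fresh noise\<close>

text \<open>Causality, used to write a state as a function of finitely many coordinates of the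
  noise.\<close>

lemma closed_loop_cong:
  "(\<And>s. s < t \<Longrightarrow> w s = w' s) \<Longrightarrow> closed_loop F f z w t = closed_loop F f z w' t"
  by (induction t) auto

lemma closed_loop_in:
  assumes "z \<in> Z" "\<And>s. w s \<in> V" "\<And>z x. z \<in> Z \<Longrightarrow> x \<in> V \<Longrightarrow> F z (f z) + x \<in> Z"
  shows "closed_loop F f z w t \<in> Z"
  using assms by (induction t) auto

text \<open>A policy is measurable only on \<open>Z\<close>. This allows it to be exchanged for an
  extension to the whole space without altering any trajectory.\<close>

lemma closed_loop_cong_on:
  assumes "z \<in> Z" "\<And>s. w s \<in> V" "\<And>z x. z \<in> Z \<Longrightarrow> x \<in> V \<Longrightarrow> F z (f z) + x \<in> Z"
    and "\<And>z. z \<in> Z \<Longrightarrow> f z = f' z"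
  shows "closed_loop F f z w t = closed_loop F f' z w t"
proof (induction t)
  case (Suc t)
  have "closed_loop F f z w t \<in> Z" using assms(1-3) by (rule closed_loop_in)
  then show ?case using Suc assms(4) by simp
qed simp

text \<open>Measurability is asked only of the noise before \<open>t\<close>, so that the lemma also
  applies on a product with finitely many coordinates.\<close>

lemma borel_measurable_closed_loop:
  fixes F :: "'e::euclidean_space \<Rightarrow> 'e \<Rightarrow> 'e"
  assumes Fm: "(\<lambda>(z, a). F z a) \<in> borel_measurable (borel \<Otimes>\<^sub>M borel)"
    and f: "f \<in> borel_measurable borel"
    and z: "z \<in> borel_measurable N" and w: "\<And>s. s < t \<Longrightarrow> (\<lambda>\<omega>. w \<omega> s) \<in> borel_measurable N"
  shows "(\<lambda>\<omega>. closed_loop F f (z \<omega>) (w \<omega>) t) \<in> borel_measurable N"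
  using w
proof (induction t)
  case (Suc t)
  then have IH: "(\<lambda>\<omega>. closed_loop F f (z \<omega>) (w \<omega>) t) \<in> borel_measurable N" by auto
  have "(\<lambda>\<omega>. F (closed_loop F f (z \<omega>) (w \<omega>) t) (f (closed_loop F f (z \<omega>) (w \<omega>) t))) \<in> borel_measurable N"
    using measurable_compose[OF measurable_Pair[OF IH measurable_compose[OF IH f]] Fm] by simp
  then show ?case using Suc.prems[of t] by simp
qed (simp add: z)

text \<open>The state at time \<open>t\<close> is a function of the initial state and of the noise
  before \<open>t\<close>, a block of coordinates disjoint from that of \<open>v t\<close>.\<close>

lemma (in prob_space) indep_closed_loop_noise:
  fixes F :: "'e::euclidean_space \<Rightarrow> 'e \<Rightarrow> 'e"
  assumes Fm: "(\<lambda>(z, a). F z a) \<in> borel_measurable (borel \<Otimes>\<^sub>M borel)"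
    and f: "f \<in> borel_measurable borel"
    and ind: "indep_vars (\<lambda>_. borel) (case_nat z0 v) UNIV"
  shows "indep_var borel (\<lambda>\<omega>. closed_loop F f (z0 \<omega>) (\<lambda>s. v s \<omega>) t) borel (v t)"
proof -
  let ?Y = "case_nat z0 v"
  \<comment> \<open>The initial state occupies index 0, so the noise of time s sits at index
    \<open>Suc s\<close>; the last one read is at index \<open>t\<close>.\<close>
  let ?G = "\<lambda>y. closed_loop F f (y 0) (\<lambda>s. y (Suc s)) t"
  have "indep_var (PiM {..t} (\<lambda>_. borel)) (\<lambda>\<omega>. \<lambda>i\<in>{..t}. ?Y i \<omega>) (PiM {Suc t} (\<lambda>_. borel)) (\<lambda>\<omega>. \<lambda>i\<in>{Suc t}. ?Y i \<omega>)"
    using ind by (rule indep_var_restrict) auto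
  moreover have "?G \<in> borel_measurable (PiM {..t} (\<lambda>_. borel))"
    by (intro borel_measurable_closed_loop Fm f measurable_component_singleton) auto
  moreover have "(\<lambda>y. y (Suc t)) \<in> borel_measurable (PiM {Suc t} (\<lambda>_. borel))"
    by (intro measurable_component_singleton) auto
  ultimately have "indep_var borel (?G \<circ> (\<lambda>\<omega>. \<lambda>i\<in>{..t}. ?Y i \<omega>)) borel ((\<lambda>y. y (Suc t)) \<circ> (\<lambda>\<omega>. \<lambda>i\<in>{Suc t}. ?Y i \<omega>))"
    by (rule indep_var_compose)
  moreover have "?G \<circ> (\<lambda>\<omega>. \<lambda>i\<in>{..t}. ?Y i \<omega>) = (\<lambda>\<omega>. closed_loop F f (z0 \<omega>) (\<lambda>s. v s \<omega>) t)"
    \<comment> \<open>hence ?G cannot see that the restricted sequence is \<open>undefined\<close>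
      beyond index \<open>t\<close>.\<close>
    by (auto simp: fun_eq_iff intro!: closed_loop_cong)
  moreover have "(\<lambda>y. y (Suc t)) \<circ> (\<lambda>\<omega>. \<lambda>i\<in>{Suc t}. ?Y i \<omega>) = v t" by (auto simp: fun_eq_iff)
  ultimately show ?thesis by simp
qed

text \<open>By independence the joint law is a product; Fubini freezes the value x of
  \<open>X\<close>, and the bound, being uniform in x, survives the outer integration.\<close>

lemma (in prob_space) prob_indep_sum_le:
  fixes X W :: "'a \<Rightarrow> 'e::euclidean_space"
  assumes ind: "indep_var borel X borel W" and U: "U \<in> sets borel"
    and le: "\<And>x. prob {\<omega> \<in> space M. x + W \<omega> \<in> U} \<le> c"
  shows "prob {\<omega> \<in> space M. X \<omega> + W \<omega> \<in> U} \<le> c"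
proof -
  note [measurable] = U
  have [measurable]: "X \<in> borel_measurable M" "W \<in> borel_measurable M"
    and eq: "distr M borel X \<Otimes>\<^sub>M distr M borel W = distr M (borel \<Otimes>\<^sub>M borel) (\<lambda>x. (X x, W x))"
    using ind by (auto simp: indep_var_distribution_eq)
  interpret X: prob_space "distr M borel X" by (rule prob_space_distr) simp
  interpret W: prob_space "distr M borel W" by (rule prob_space_distr) simp
  have c: "c \<ge> 0" using le[of 0] measure_nonneg order.trans by blast
  have "emeasure M {\<omega> \<in> space M. X \<omega> + W \<omega> \<in> U} = (\<integral>\<^sup>+\<omega>. indicator U (X \<omega> + W \<omega>) \<partial>M)"
    by (subst nn_integral_indicator[symmetric], measurable) (intro nn_integral_cong, simp add: indicator_def)
  also have "\<dots> = (\<integral>\<^sup>+p. indicator U (fst p + snd p) \<partial>distr M (borel \<Otimes>\<^sub>M borel) (\<lambda>x. (X x, W x)))"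
    by (subst nn_integral_distr) auto
  also have "\<dots> = (\<integral>\<^sup>+x. \<integral>\<^sup>+w. indicator U (x + w) \<partial>distr M borel W \<partial>distr M borel X)"
    unfolding eq[symmetric] by (subst W.nn_integral_fst[symmetric]) auto
  also have "\<dots> \<le> (\<integral>\<^sup>+x. ennreal c \<partial>distr M borel X)"
  proof (rule nn_integral_mono)
    fix x
    have "(\<integral>\<^sup>+w. indicator U (x + w) \<partial>distr M borel W) = (\<integral>\<^sup>+\<omega>. indicator U (x + W \<omega>) \<partial>M)"
      by (subst nn_integral_distr) auto
    also have "\<dots> = emeasure M {\<omega> \<in> space M. x + W \<omega> \<in> U}"
      by (subst nn_integral_indicator[symmetric], measurable) (intro nn_integral_cong, simp add: indicator_def)
    also have "\<dots> \<le> ennreal c" using le[of x] by (simp add: emeasure_eq_measure ennreal_leI)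
    finally show "(\<integral>\<^sup>+w. indicator U (x + w) \<partial>distr M borel W) \<le> ennreal c" .
  qed
  also have "\<dots> = ennreal c" using X.emeasure_space_1 by simp
  finally show ?thesis using c by (simp add: emeasure_eq_measure)
qed

section \<open>Realising the path measure on a product space\<close>

text \<open>Records all that the cost computations need: the path law is the image of
  \<open>N\<close> under a state process followed by the policy. How that process was constructed is
  forgotten.\<close>

locale controlled_path = prob_space N
  for N :: "'n measure" and m :: "('s, 'a) mdp" and f :: "'s \<Rightarrow> 'a" and \<mu> :: "'s measure"
    and x :: "nat \<Rightarrow> 'n \<Rightarrow> 's" +
  assumes policy_measurable: "f \<in> states m \<rightarrow>\<^sub>M actions m"
    and path_measurable: "x t \<in> N \<rightarrow>\<^sub>M states m"
    and path_measure_eq: "path_measure m \<mu> (stationary m f) =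
      distr N (PiM UNIV (\<lambda>_. state_action_space m)) (\<lambda>\<omega> t. (x t \<omega>, f (x t \<omega>)))"

text \<open>The sample space is a product with \<open>\<mu>\<close> at index 0 and the noise law at
  all others, so the independence required by \<open>path_measure_closed_loop\<close> is built in.
  The last conclusion is the form in which randomness is used later: a bound valid for all
  translates of the noise passes to every state after time 0.\<close>

lemma closed_loop_realisation:
  fixes F :: "'e::euclidean_space \<Rightarrow> 'e \<Rightarrow> 'e" and v0 :: "'w \<Rightarrow> 'e"
  assumes Fm: "(\<lambda>(z, a). F z a) \<in> borel_measurable (borel \<Otimes>\<^sub>M borel)"
    and M: "prob_space M" and v0: "v0 \<in> borel_measurable M" and ae: "AE \<omega> in M. v0 \<omega> \<in> V"
    and V: "compact V" and Z: "compact Z"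
    and inv: "\<And>z a x. z \<in> Z \<Longrightarrow> a \<in> Z \<Longrightarrow> x \<in> V \<Longrightarrow> F z a + x \<in> Z"
    and m: "m = additive_noise_mdp Z F M v0"
    and \<mu>: "\<mu> \<in> space (prob_algebra (states m))"
    and f: "f \<in> states m \<rightarrow>\<^sub>M actions m"
  obtains N :: "(nat \<Rightarrow> 'e) measure" and x where "controlled_path N m f \<mu> x"
    "distr N (states m) (x 0) = \<mu>"
    "\<forall>U\<in>sets borel. \<forall>c t. (\<forall>y. measure M {\<omega> \<in> space M. y + v0 \<omega> \<in> U} \<le> c) \<longrightarrow>
      measure N {\<omega> \<in> space N. x (Suc t) \<omega> \<in> U} \<le> c"
proof -
  interpret M: prob_space M by fact
  note [measurable] = v0
  define D where "D = distr M borel v0"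
  interpret D: prob_space D unfolding D_def by (rule M.prob_space_distr) simp
  have sD[measurable_cong]: "sets D = sets borel" by (simp add: D_def)
  have Zb[measurable]: "Z \<in> sets borel" and Vb[measurable]: "V \<in> sets borel"
    using Z V by (auto dest: compact_imp_closed)
  have st: "states m = restrict_space borel Z" "actions m = restrict_space borel Z"
    by (auto simp: m additive_noise_mdp_def)
  have aeD: "AE x in D. x \<in> V" unfolding D_def using ae by (subst AE_distr_iff) auto
  \<comment> \<open>Restriction to \<open>V\<close> turns almost sure membership into membership at
    every point; \<open>dDV\<close> checks that the law is unchanged.\<close>
  define DV where "DV = restrict_space D V"
  have spDV: "space DV = V" by (simp add: DV_def space_restrict_space D_def)
  have eDV: "emeasure D V = 1" using aeD D.emeasure_eq_1_AE[of V] by (simp add: sD)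
  then have pDV: "prob_space DV"
    by (intro prob_spaceI) (simp add: DV_def emeasure_restrict_space sD space_restrict_space D_def)
  have idDV: "(\<lambda>x. x) \<in> DV \<rightarrow>\<^sub>M borel"
    unfolding DV_def by (intro measurable_restrict_space1) (simp add: D_def)
  have dDV: "distr DV borel (\<lambda>x. x) = D"
  proof (rule measure_eqI)
    fix A assume "A \<in> sets (distr DV borel (\<lambda>x. x))"
    then have A[measurable]: "A \<in> sets borel" by simp
    have "emeasure (distr DV borel (\<lambda>x. x)) A = emeasure DV (A \<inter> V)"
      using idDV by (subst emeasure_distr) (auto simp: spDV)
    also have "\<dots> = emeasure D (A \<inter> V)"
      unfolding DV_def by (rule emeasure_restrict_space) (auto simp: sD)
    also have "\<dots> = emeasure D A"
      by (rule emeasure_eq_AE) (use aeD in \<open>auto simp: sD\<close>)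
    finally show "emeasure (distr DV borel (\<lambda>x. x)) A = emeasure D A" .
  qed (simp add: sD)
  have s\<mu>: "sets \<mu> = sets (restrict_space borel Z)" and p\<mu>: "prob_space \<mu>"
    using \<mu> by (auto simp: space_prob_algebra st)
  have sp\<mu>: "space \<mu> = Z" using sets_eq_imp_space_eq[OF s\<mu>] by (simp add: space_restrict_space)
  have id\<mu>: "(\<lambda>x. x) \<in> \<mu> \<rightarrow>\<^sub>M borel"
    unfolding measurable_cong_sets[OF s\<mu> refl] by (simp add: measurable_restrict_space1)
  define K where "K = (case_nat \<mu> (\<lambda>_. DV) :: nat \<Rightarrow> 'e measure)"
  define N where "N = PiM UNIV K"
  have pK: "prob_space (K i)" for i by (simp add: K_def p\<mu> pDV split: nat.split)
  interpret N: prob_space N unfolding N_def by (rule prob_space_PiM) (rule pK)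
  define z0 where "z0 = (\<lambda>\<omega> :: nat \<Rightarrow> 'e. \<omega> 0)"
  define w where "w = (\<lambda>t (\<omega> :: nat \<Rightarrow> 'e). \<omega> (Suc t))"
  have comp: "(\<lambda>\<omega>. \<omega> i) \<in> N \<rightarrow>\<^sub>M K i" for i unfolding N_def by simp
  have idK: "(\<lambda>x. x) \<in> K i \<rightarrow>\<^sub>M borel" for i by (simp add: K_def id\<mu> idDV split: nat.split)
  \<comment> \<open>Independence holds because the coordinates have joint law \<open>N\<close>, the
    product of their marginals. The target spaces are then relaxed from \<open>K i\<close> to
    \<open>borel\<close>.\<close>
  have "N.indep_vars K (\<lambda>i \<omega>. \<omega> i) UNIV"
  proof (subst N.indep_vars_iff_distr_eq_PiM)
    have "distr N (PiM UNIV K) (\<lambda>x. \<lambda>i\<in>UNIV. x i) = N"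
      unfolding N_def by (simp add: restrict_UNIV distr_id)
    moreover have "distr N (K i) (\<lambda>x. x i) = K i" for i
      unfolding N_def by (rule distr_PiM_component) (auto intro: pK)
    ultimately show "distr N (PiM UNIV K) (\<lambda>x. \<lambda>i\<in>UNIV. x i) = PiM UNIV (\<lambda>i. distr N (K i) (\<lambda>x. x i))"
      by (simp add: N_def)
  qed (auto intro: comp)
  then have "N.indep_vars (\<lambda>_. borel) (\<lambda>i \<omega>. \<omega> i) UNIV"
    by (rule N.indep_vars_compose2) (rule idK)
  moreover have "(\<lambda>i \<omega>. \<omega> i) = case_nat z0 w"
    by (auto simp: fun_eq_iff z0_def w_def split: nat.split)
  ultimately have ind: "N.indep_vars (\<lambda>_. borel) (case_nat z0 w) UNIV" by simp
  have wN[measurable]: "w t \<in> borel_measurable N" for t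
    unfolding w_def using measurable_compose[OF comp idK] .
  have dw: "distr N borel (w t) = D" for t
  proof -
    have "distr N borel (w t) = distr (distr N (K (Suc t)) (\<lambda>\<omega>. \<omega> (Suc t))) borel (\<lambda>x. x)"
      using comp idK by (subst distr_distr) (auto simp: w_def comp_def)
    also have "distr N (K (Suc t)) (\<lambda>\<omega>. \<omega> (Suc t)) = K (Suc t)"
      unfolding N_def by (rule distr_PiM_component) (auto intro: pK)
    finally show ?thesis using dDV by (simp add: K_def)
  qed
  have spN: "\<omega> i \<in> space (K i)" if "\<omega> \<in> space N" for \<omega> i
    using that by (auto simp: N_def space_PiM)
  have wV: "w t \<omega> \<in> V" if "\<omega> \<in> space N" for t \<omega>
    using spN[OF that, of "Suc t"] by (simp add: w_def K_def spDV)
  have zZ: "z0 \<omega> \<in> Z" if "\<omega> \<in> space N" for \<omega>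
    using spN[OF that, of 0] by (simp add: z0_def K_def sp\<mu>)
  have dz: "distr N (states m) z0 = \<mu>"
  proof -
    have "distr N (states m) z0 = distr N (K 0) (\<lambda>\<omega>. \<omega> 0)"
      by (rule distr_cong) (auto simp: z0_def K_def st s\<mu>)
    also have "\<dots> = \<mu>" using distr_PiM_component[of UNIV K 0] pK by (simp add: N_def K_def)
    finally show ?thesis .
  qed
  \<comment> \<open>The noise enters the process only through the laws of its translates, so the new
    noise defines the same \<open>m\<close>.\<close>
  have mN: "m = additive_noise_mdp Z F N (w 0)"
  proof -
    have "distr M borel (\<lambda>\<omega>. y + v0 \<omega>) = distr N borel (\<lambda>\<omega>. y + w 0 \<omega>)" for y
    proof -
      have "distr M borel (\<lambda>\<omega>. y + v0 \<omega>) = distr D borel (\<lambda>x. y + x)"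
        unfolding D_def by (subst distr_distr) (auto simp: comp_def)
      also have "\<dots> = distr N borel (\<lambda>\<omega>. y + w 0 \<omega>)"
        unfolding dw[of 0, symmetric] by (subst distr_distr) (auto simp: comp_def)
      finally show ?thesis .
    qed
    then show ?thesis by (simp add: m additive_noise_mdp_def)
  qed
  define x where "x t \<omega> = closed_loop F f (z0 \<omega>) (\<lambda>s. w s \<omega>) t" for t \<omega>
  have fZ: "f z \<in> Z" if "z \<in> Z" for z
    using measurable_space[OF f, of z] that by (simp add: st space_restrict_space)
  have pm: "path_measure m \<mu> (stationary m f) =
      distr N (PiM UNIV (\<lambda>_. state_action_space m)) (\<lambda>\<omega> t. (x t \<omega>, f (x t \<omega>)))"
    using path_measure_closed_loop[OF Fm N.prob_space_axioms ind _ wV zZ Z inv mN f]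
    by (simp add: dw dz x_def Let_def)
  \<comment> \<open>The path stays in \<open>Z\<close>, so \<open>f\<close> may be replaced by a Borel function on the whole space.\<close>
  define f' where "f' z = (if z \<in> Z then f z else 0)" for z
  have f': "f' \<in> borel_measurable borel"
  proof -
    have "f \<in> borel_measurable (restrict_space borel Z)"
      using measurable_compose[OF f, of "\<lambda>x. x" borel] by (simp add: st measurable_restrict_space1)
    then show ?thesis
      unfolding f'_def[abs_def] by (subst (asm) measurable_restrict_space_iff[where c=0]) auto
  qed
  have x': "x t \<omega> = closed_loop F f' (z0 \<omega>) (\<lambda>s. w s \<omega>) t" if "\<omega> \<in> space N" for t \<omega>
    unfolding x_def using that by (intro closed_loop_cong_on[of _ Z _ V]) (auto simp: zZ wV inv fZ f'_def)
  have xZ: "x t \<omega> \<in> Z" if "\<omega> \<in> space N" for t \<omega>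
    unfolding x_def using that by (intro closed_loop_in[of _ Z _ V]) (auto simp: zZ wV inv fZ)
  have z0N: "z0 \<in> borel_measurable N" unfolding z0_def using measurable_compose[OF comp idK] .
  have xN: "x t \<in> borel_measurable N" for t
    using borel_measurable_closed_loop[OF Fm f' z0N, of t "\<lambda>\<omega> s. w s \<omega>"] wN
    by (subst measurable_cong[OF x']) auto
  have xm: "x t \<in> N \<rightarrow>\<^sub>M states m" for t
    unfolding st by (intro measurable_restrict_space2 xN) (auto simp: xZ)
  \<comment> \<open>The state at \<open>Suc t\<close> is the sum of the prediction
    \<open>F z (f' z)\<close>, a function of the state z at time \<open>t\<close>, and of the
    independent noise \<open>w t\<close>.\<close>
  have step: "measure N {\<omega> \<in> space N. x (Suc t) \<omega> \<in> U} \<le> c"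
    if U[measurable]: "U \<in> sets borel" and c: "\<And>y. measure M {\<omega> \<in> space M. y + v0 \<omega> \<in> U} \<le> c" for U c t
  proof -
    have FX: "(\<lambda>z. F z (f' z)) \<in> borel_measurable borel"
      using measurable_compose[OF measurable_Pair[OF measurable_ident f'] Fm] by simp
    let ?X = "\<lambda>\<omega>. closed_loop F f' (z0 \<omega>) (\<lambda>s. w s \<omega>) t"
    have "N.indep_var borel ((\<lambda>z. F z (f' z)) \<circ> ?X) borel ((\<lambda>x. x) \<circ> w t)"
      by (rule N.indep_var_compose[OF N.indep_closed_loop_noise[OF Fm f' ind] FX]) simp
    then have iv: "N.indep_var borel (\<lambda>\<omega>. F (?X \<omega>) (f' (?X \<omega>))) borel (w t)"
      by (simp add: comp_def)
    have wU: "N.prob {\<omega> \<in> space N. y + w t \<omega> \<in> U} \<le> c" for y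
    proof -
      have "N.prob {\<omega> \<in> space N. y + w t \<omega> \<in> U} = measure (distr N borel (w t)) {x. y + x \<in> U}"
        by (subst measure_distr) (auto intro!: arg_cong[where f="measure N"])
      also have "\<dots> = measure (distr M borel v0) {x. y + x \<in> U}" by (simp add: dw D_def)
      also have "\<dots> = measure M {\<omega> \<in> space M. y + v0 \<omega> \<in> U}"
        by (subst measure_distr) (auto intro!: arg_cong[where f="measure M"])
      finally show ?thesis using c[of y] by simp
    qed
    have "{\<omega> \<in> space N. x (Suc t) \<omega> \<in> U} = {\<omega> \<in> space N. F (?X \<omega>) (f' (?X \<omega>)) + w t \<omega> \<in> U}"
      using x'[of _ "Suc t"] by auto
    with N.prob_indep_sum_le[OF iv U wU] show ?thesis by simp
  qed
  have x0: "x 0 = z0" by (auto simp: x_def)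
  have "controlled_path N m f \<mu> x"
    by (intro controlled_path.intro controlled_path_axioms.intro N.prob_space_axioms f xm pm)
  moreover have "distr N (states m) (x 0) = \<mu>" by (simp add: x0 dz)
  ultimately show thesis by (rule that) (use step in auto)
qed

section \<open>Costs as series of expected stage costs\<close>

text \<open>Needed for general policies, which have no closed-loop description: it places every
  sample path in the product space, where the cost bounds apply pointwise.\<close>

lemma space_path_measure:
  assumes tr: "(\<lambda>(z, a). transition m z a) \<in> states m \<Otimes>\<^sub>M actions m \<rightarrow>\<^sub>M prob_algebra (states m)"
    and mu: "\<mu> \<in> space (prob_algebra (states m))" and pi: "\<pi> \<in> policies m"
  shows "space (path_measure m \<mu> \<pi>) = space (PiM UNIV (\<lambda>_. state_action_space m))"
proof -
  interpret IT: Ionescu_Tulcea "stage_kernel m \<mu> \<pi>" "\<lambda>_. state_action_space m"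
    using assms by (rule Ionescu_Tulcea_stage_kernel)
  show ?thesis by (simp add: path_measure_def)
qed

lemma summable_discounted:
  fixes c :: "nat \<Rightarrow> real"
  assumes "0 < \<beta>" "\<beta> < 1" "\<And>t. \<bar>c t\<bar> \<le> C"
  shows "summable (\<lambda>t. \<beta> ^ t * c t)"
proof (rule summable_comparison_test'[where g="\<lambda>t. \<beta> ^ t * C" and N=0])
  show "summable (\<lambda>t. \<beta> ^ t * C)" using assms by (intro summable_mult2 summable_geometric) auto
  show "norm (\<beta> ^ t * c t) \<le> \<beta> ^ t * C" for t
    using assms by (auto simp: abs_mult intro!: mult_left_mono)
qed

text \<open>With a policy of cost 0 at hand, this is what optimality amounts to. The upper bound
  \<open>C\<close> secures convergence of the series, and integrability can be bypassed because a
  non-integrable function has integral 0.\<close>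

lemma discounted_cost_nonneg:
  assumes tr: "(\<lambda>(z, a). transition m z a) \<in> states m \<Otimes>\<^sub>M actions m \<rightarrow>\<^sub>M prob_algebra (states m)"
    and mu: "\<mu> \<in> space (prob_algebra (states m))" and pi: "\<pi> \<in> policies m"
    and \<beta>: "0 < \<beta>" "\<beta> < 1"
    and cost: "\<And>z a. z \<in> space (states m) \<Longrightarrow> a \<in> space (actions m) \<Longrightarrow> 0 \<le> cost m z a \<and> cost m z a \<le> C"
  shows "0 \<le> discounted_cost m \<beta> \<pi> \<mu>"
  unfolding discounted_cost_def
proof (intro integral_nonneg_AE AE_I2)
  fix \<omega> assume "\<omega> \<in> space (path_measure m \<mu> \<pi>)"
  then have "\<omega> t \<in> space (state_action_space m)" for t
    using space_path_measure[OF tr mu pi] by (auto simp: space_PiM)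
  then have c: "0 \<le> cost m (fst (\<omega> t)) (snd (\<omega> t)) \<and> cost m (fst (\<omega> t)) (snd (\<omega> t)) \<le> C" for t
    by (metis cost mem_Times_iff space_pair_measure)
  show "0 \<le> (\<Sum>t. \<beta> ^ t * cost m (fst (\<omega> t)) (snd (\<omega> t)))"
    using c \<beta> by (intro suminf_nonneg summable_discounted[where C=C]) auto
qed

lemma average_cost_nonneg:
  assumes tr: "(\<lambda>(z, a). transition m z a) \<in> states m \<Otimes>\<^sub>M actions m \<rightarrow>\<^sub>M prob_algebra (states m)"
    and mu: "\<mu> \<in> space (prob_algebra (states m))" and pi: "\<pi> \<in> policies m"
    and cost: "\<And>z a. z \<in> space (states m) \<Longrightarrow> a \<in> space (actions m) \<Longrightarrow> 0 \<le> cost m z a"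
  shows "0 \<le> average_cost m \<pi> \<mu>"
  unfolding average_cost_def
proof (intro le_Limsup always_eventually allI)
  fix T
  have "0 \<le> (\<integral>\<omega>. (\<Sum>t<T. cost m (fst (\<omega> t)) (snd (\<omega> t))) \<partial>path_measure m \<mu> \<pi>)"
  proof (intro integral_nonneg_AE AE_I2 sum_nonneg)
    fix \<omega> t assume "\<omega> \<in> space (path_measure m \<mu> \<pi>)"
    then have "\<omega> t \<in> space (state_action_space m)"
      by (auto simp: space_path_measure[OF tr mu pi] space_PiM)
    then show "0 \<le> cost m (fst (\<omega> t)) (snd (\<omega> t))"
      by (intro cost) (auto simp: space_pair_measure)
  qed
  then show "0 \<le> ereal (1 / real T * (\<integral>\<omega>. (\<Sum>t<T. cost m (fst (\<omega> t)) (snd (\<omega> t))) \<partial>path_measure m \<mu> \<pi>))"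
    by simp
qed simp

text \<open>Transport to \<open>N\<close> reduces both criteria to the sequence of expected stage
  costs. Bounded costs and geometric weights justify exchanging the series with the
  expectation.\<close>

lemma (in controlled_path)
  assumes cm: "(\<lambda>(z, a). cost m z a) \<in> borel_measurable (state_action_space m)"
    and cost: "\<And>z a. z \<in> space (states m) \<Longrightarrow> a \<in> space (actions m) \<Longrightarrow> \<bar>cost m z a\<bar> \<le> C"
  shows integrable_stage_cost: "integrable N (\<lambda>\<omega>. cost m (x t \<omega>) (f (x t \<omega>)))"
    and discounted_cost_stationary: "0 < \<beta> \<Longrightarrow> \<beta> < 1 \<Longrightarrow>
      discounted_cost m \<beta> (stationary m f) \<mu> = (\<Sum>t. \<beta> ^ t * (\<integral>\<omega>. cost m (x t \<omega>) (f (x t \<omega>)) \<partial>N))"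
    and average_cost_stationary: "average_cost m (stationary m f) \<mu> =
      limsup (\<lambda>T. ereal (1 / real T * (\<Sum>t<T. \<integral>\<omega>. cost m (x t \<omega>) (f (x t \<omega>)) \<partial>N)))"
proof -
  note x = path_measurable and f = policy_measurable and pm = path_measure_eq
  note [measurable] = x f
  let ?P = "PiM UNIV (\<lambda>_::nat. state_action_space m)"
  have X: "(\<lambda>\<omega> t. (x t \<omega>, f (x t \<omega>))) \<in> N \<rightarrow>\<^sub>M ?P"
    by (rule measurable_PiM_single') (auto simp: space_pair_measure intro: measurable_space[OF x] measurable_space[OF measurable_compose[OF x f]])
  have c: "(\<lambda>\<omega>. cost m (fst (\<omega> t)) (snd (\<omega> t))) \<in> borel_measurable ?P" for t
    using measurable_compose[OF measurable_component_singleton[of t UNIV "\<lambda>_. state_action_space m"] cm]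
    by (simp add: split_beta')
  have cx[measurable]: "(\<lambda>\<omega>. cost m (x t \<omega>) (f (x t \<omega>))) \<in> borel_measurable N" for t
    using measurable_compose[OF X c[of t]] by simp
  have bound: "\<bar>cost m (x t \<omega>) (f (x t \<omega>))\<bar> \<le> C" if "\<omega> \<in> space N" for t \<omega>
    using that by (intro cost measurable_space[OF x] measurable_space[OF measurable_compose[OF x f]])
  show int: "integrable N (\<lambda>\<omega>. cost m (x t \<omega>) (f (x t \<omega>)))" for t
    by (rule integrable_const_bound[where B=C]) (auto simp: bound)
  show "average_cost m (stationary m f) \<mu> =
      limsup (\<lambda>T. ereal (1 / real T * (\<Sum>t<T. \<integral>\<omega>. cost m (x t \<omega>) (f (x t \<omega>)) \<partial>N)))"
    unfolding average_cost_def pm using c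
    by (subst integral_distr[OF X]) (auto simp: int Bochner_Integration.integral_sum)
  show "discounted_cost m \<beta> (stationary m f) \<mu> = (\<Sum>t. \<beta> ^ t * (\<integral>\<omega>. cost m (x t \<omega>) (f (x t \<omega>)) \<partial>N))"
    if \<beta>: "0 < \<beta>" "\<beta> < 1"
  proof -
    have "discounted_cost m \<beta> (stationary m f) \<mu> = (\<integral>\<omega>. (\<Sum>t. \<beta> ^ t * cost m (x t \<omega>) (f (x t \<omega>))) \<partial>N)"
      unfolding discounted_cost_def pm using c
      by (subst integral_distr[OF X]) (auto intro!: borel_measurable_suminf)
    also have "\<dots> = (\<Sum>t. \<integral>\<omega>. \<beta> ^ t * cost m (x t \<omega>) (f (x t \<omega>)) \<partial>N)"
    proof (rule integral_suminf)
      show "integrable N (\<lambda>\<omega>. \<beta> ^ t * cost m (x t \<omega>) (f (x t \<omega>)))" for t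
        using int by simp
      show "AE \<omega> in N. summable (\<lambda>t. norm (\<beta> ^ t * cost m (x t \<omega>) (f (x t \<omega>))))"
        using summable_discounted[OF \<beta>, of "\<lambda>t. \<bar>cost m (x t _) (f (x t _))\<bar>" C] bound \<beta>
        by (intro AE_I2) (simp add: abs_mult)
      have "summable (\<lambda>t. \<beta> ^ t * (\<integral>\<omega>. \<bar>cost m (x t \<omega>) (f (x t \<omega>))\<bar> \<partial>N))"
      proof (rule summable_discounted[OF \<beta>])
        fix t
        have "(\<integral>\<omega>. \<bar>cost m (x t \<omega>) (f (x t \<omega>))\<bar> \<partial>N) \<le> (\<integral>\<omega>. C \<partial>N)"
          by (intro integral_mono integrable_abs int) (auto simp: bound)
        then show "\<bar>\<integral>\<omega>. \<bar>cost m (x t \<omega>) (f (x t \<omega>))\<bar> \<partial>N\<bar> \<le> C"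
          by (simp add: prob_space)
      qed
      then show "summable (\<lambda>t. \<integral>\<omega>. norm (\<beta> ^ t * cost m (x t \<omega>) (f (x t \<omega>))) \<partial>N)"
        using \<beta> by (simp add: abs_mult)
    qed
    finally show ?thesis by simp
  qed
qed

text \<open>Markov's inequality read from below: off \<open>B\<close> the integrand is at least
  \<open>r\<close>, and the complement of \<open>B\<close> has probability at least 1 -
  \<open>p\<close>.\<close>

lemma (in prob_space) integral_ge_if_prob_le:
  assumes h: "integrable M h" "\<And>\<omega>. \<omega> \<in> space M \<Longrightarrow> 0 \<le> h \<omega>"
    and B: "B \<in> events" "prob B \<le> p" and r: "r \<ge> 0"
    and le: "\<And>\<omega>. \<omega> \<in> space M \<Longrightarrow> \<omega> \<notin> B \<Longrightarrow> r \<le> h \<omega>"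
  shows "r * (1 - p) \<le> (\<integral>\<omega>. h \<omega> \<partial>M)"
proof -
  have "r * (1 - p) \<le> r * prob (space M - B)"
    using B r by (intro mult_left_mono) (simp_all add: prob_compl)
  also have "\<dots> = (\<integral>\<omega>. r * indicator (space M - B) \<omega> \<partial>M)"
  proof -
    have "has_bochner_integral M (indicator (space M - B)) (prob (space M - B))"
      using B by (intro has_bochner_integral_real_indicator) (auto simp: emeasure_eq_measure)
    then show ?thesis by (simp only: integral_mult_right_zero has_bochner_integral_integral_eq)
  qed
  also have "\<dots> \<le> (\<integral>\<omega>. h \<omega> \<partial>M)"
  proof (rule integral_mono)
    show "integrable M (\<lambda>\<omega>. r * indicator (space M - B) \<omega>)"
      using B by (intro integrable_mult_right integrable_real_indicator) (auto simp: emeasure_eq_measure)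
  qed (auto simp: indicator_def h le)
  finally show ?thesis .
qed

section \<open>Optimality of the identity and the lower bound for quantised policies\<close>

theorem mainTheorem10:
  fixes F :: "real ^ 'd \<Rightarrow> real ^ 'd \<Rightarrow> real ^ 'd"
    and M :: "'w measure"
    and v :: "nat \<Rightarrow> 'w \<Rightarrow> real ^ 'd"
    and g :: "real ^ 'd \<Rightarrow> real"
    and V Z :: "(real ^ 'd) set"
    and Zn :: "nat \<Rightarrow> (real ^ 'd) set"
    and Q :: "nat \<Rightarrow> real ^ 'd \<Rightarrow> real ^ 'd"
    and \<nu> :: "nat \<Rightarrow> (real ^ 'd) measure"
    and m :: "(real ^ 'd, real ^ 'd) mdp"
    and \<mu> :: "(real ^ 'd) measure"
    and m_approx :: "nat \<Rightarrow> (real ^ 'd, real ^ 'd) mdp"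
  assumes "(\<lambda>(z, a). F z a) \<in> borel_measurable (borel \<Otimes>\<^sub>M borel)"
    and "(SUP (z, a)\<in>UNIV - {(0, 0)}. ereal (norm (F z a) / (norm z + norm a))) < ereal (1 / 2)"
    and "prob_space M"
    and "prob_space.indep_vars M (\<lambda>_. borel) v UNIV"
    and "\<And>x. 0 \<le> g x"
    and "\<And>t. distributed M lborel (v t) (\<lambda>x. ennreal (g x))"
    and "compact V"
    and "\<And>x. x \<notin> V \<Longrightarrow> g x = 0"
    and "integrable lborel (\<lambda>x. g x * ln (g x))"
    and "compact Z"
    and "V \<subseteq> Z"
    and "\<And>z a x. z \<in> Z \<Longrightarrow> a \<in> Z \<Longrightarrow> x \<in> V \<Longrightarrow> F z a + x \<in> Z"
    and "\<And>n. n \<ge> 1 \<Longrightarrow> Zn n \<subseteq> Z \<and> card (Zn n) = n"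
    and "\<And>n. n \<ge> 1 \<Longrightarrow> nearest_neighbour_map Z (Zn n) (Q n)"
    and "\<And>n. n \<ge> 1 \<Longrightarrow> \<nu> n \<in> space (prob_algebra (restrict_space borel Z))"
    and "\<And>n y. n \<ge> 1 \<Longrightarrow> y \<in> Zn n \<Longrightarrow> emeasure (\<nu> n) (cell m (Q n) y) > 0"
    and "m = additive_noise_mdp Z F M (v 0)"
    and "\<mu> = restrict_space (density lborel (\<lambda>x. ennreal (g x))) Z"
    and "\<And>n. m_approx n = approx_mdp m (Zn n) (Q n) (\<nu> n)"
  shows "(\<forall>\<beta>\<in>{0<..<1}.
            optimal_stationary m (discounted_cost m \<beta>) (space (prob_algebra (states m))) (\<lambda>z. z) \<and>
            discounted_cost m \<beta> (stationary m (\<lambda>z. z)) \<mu> = 0) \<and>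
         optimal_stationary m (average_cost m) (space (prob_algebra (states m))) (\<lambda>z. z) \<and>
         average_cost m (stationary m (\<lambda>z. z)) \<mu> = 0 \<and>
         (\<exists>L>0. \<forall>n\<ge>1.
            (\<forall>\<beta>\<in>{0<..<1}. \<forall>f.
               optimal_stationary (m_approx n) (discounted_cost (m_approx n) \<beta>)
                 (dirac_distributions (m_approx n)) f \<longrightarrow>
               \<bar>discounted_cost m \<beta> (stationary m (\<lambda>z. z)) \<mu> -
                discounted_cost m \<beta> (stationary m (f \<circ> Q n)) \<mu>\<bar>
               \<ge> L / (1 - \<beta>) * (1 / real n) powr (1 / real CARD('d))) \<and>
            (\<forall>f.
               optimal_stationary (m_approx n) (average_cost (m_approx n))
                 (dirac_distributions (m_approx n)) f \<longrightarrow>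
               \<bar>average_cost m (stationary m (\<lambda>z. z)) \<mu> -
                average_cost m (stationary m (f \<circ> Q n)) \<mu>\<bar>
               \<ge> ereal (L * (1 / real n) powr (1 / real CARD('d)))))"
proof -
  note Fm = assms(1) and M = assms(3) and v = assms(6) and V = assms(7) and g0 = assms(8) and Z = assms(10)
    and VZ = assms(11) and inv = assms(12) and Zn = assms(13) and Qn = assms(14) and m = assms(17) and \<mu>_def = assms(18)
    and ma = assms(19)
  interpret M: prob_space M by fact
  have v0: "v 0 \<in> borel_measurable M" using v[of 0] by (simp add: distributed_def)
  note [measurable] = v0
  have Zb[measurable]: "Z \<in> sets borel" using Z by (auto dest: compact_imp_closed)
  define D where "D = density lborel (\<lambda>x. ennreal (g x))"
  have D: "distr M borel (v 0) = D"
  proof -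
    have "distr M lborel (v 0) = D" using v[of 0] by (simp add: distributed_def D_def)
    moreover have "distr M borel (v 0) = distr M lborel (v 0)" by (rule distr_cong) auto
    ultimately show ?thesis by simp
  qed
  have gm: "g \<in> borel_measurable borel"
  proof -
    have "(\<lambda>x. ennreal (g x)) \<in> borel_measurable borel" using v[of 0] by (simp add: distributed_def)
    then have "(\<lambda>x. enn2real (ennreal (g x))) \<in> borel_measurable borel" by simp
    then show ?thesis using assms(5) by simp
  qed
  interpret D: prob_space D unfolding D[symmetric] by (rule M.prob_space_distr) simp
  have sD[measurable_cong]: "sets D = sets borel" by (simp add: D_def)
  have Dv: "measure M {\<omega> \<in> space M. v 0 \<omega> \<in> U} = measure D U" if "U \<in> sets borel" for U
    unfolding D[symmetric] using that by (subst measure_distr) (auto intro!: arg_cong[where f="measure M"])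
  \<comment> \<open>The support condition on \<open>g\<close> constrains the noise only up to a null
    set.\<close>
  have "x \<in> V" if "0 < g x" for x using g0[of x] that by force
  then have aeD: "AE x in D. x \<in> V"
    unfolding D_def using gm by (subst AE_density) (auto intro!: AE_I2)
  have ae: "AE \<omega> in M. v 0 \<omega> \<in> V"
    using aeD unfolding D[symmetric] by (rule AE_distrD[OF v0])
  have st: "states m = restrict_space borel Z" "actions m = restrict_space borel Z"
    and cm: "cost m = (\<lambda>z a. norm (z - a))"
    by (auto simp: m additive_noise_mdp_def)
  have tr: "(\<lambda>(z, a). transition m z a) \<in> states m \<Otimes>\<^sub>M actions m \<rightarrow>\<^sub>M prob_algebra (states m)"
    using Fm M v0 ae Z inv m by (rule transition_additive_noise)
  have \<mu>: "\<mu> \<in> space (prob_algebra (states m))"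
  proof -
    have "emeasure D Z = 1" using aeD VZ by (intro D.emeasure_eq_1_AE) auto
    then have "prob_space \<mu>"
      by (intro prob_spaceI) (simp add: \<mu>_def D_def[symmetric] emeasure_restrict_space sD space_restrict_space sets_eq_imp_space_eq[OF sD])
    then show ?thesis by (simp add: space_prob_algebra \<mu>_def st sets_restrict_space)
  qed
  obtain C where C: "\<And>z. z \<in> Z \<Longrightarrow> norm z \<le> C"
    using compact_imp_bounded[OF Z] by (auto simp: bounded_iff)
  have costb: "0 \<le> cost m z a \<and> cost m z a \<le> C + C" if "z \<in> space (states m)" "a \<in> space (actions m)" for z a
    using that norm_triangle_ineq4[of z a] C[of z] C[of a] by (simp add: cm st space_restrict_space)
  then have costa: "\<bar>cost m z a\<bar> \<le> C + C" if "z \<in> space (states m)" "a \<in> space (actions m)" for z a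
    using that by fastforce
  have costm: "(\<lambda>(z, a). cost m z a) \<in> borel_measurable (state_action_space m)"
  proof -
    have "(\<lambda>x. x) \<in> restrict_space borel Z \<rightarrow>\<^sub>M (borel :: (real ^ 'd) measure)" by (simp add: measurable_restrict_space1)
    from measurable_compose[OF borel_measurable_diff[OF measurable_compose[OF measurable_fst this] measurable_compose[OF measurable_snd this]] borel_measurable_norm]
    show ?thesis by (simp add: cm st split_beta')
  qed
  have id: "(\<lambda>z. z) \<in> states m \<rightarrow>\<^sub>M actions m" unfolding st by (rule measurable_ident_sets[OF refl])
  \<comment> \<open>Under the identity every stage cost vanishes, from any initial law; optimality
    then follows from nonnegativity of the costs.\<close>
  have zero: "average_cost m (stationary m (\<lambda>z. z)) \<mu>' = 0"
      "0 < \<beta> \<Longrightarrow> \<beta> < 1 \<Longrightarrow> discounted_cost m \<beta> (stationary m (\<lambda>z. z)) \<mu>' = 0"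
    if \<mu>': "\<mu>' \<in> space (prob_algebra (states m))" for \<mu>' \<beta>
  proof -
    obtain N :: "(nat \<Rightarrow> real ^ 'd) measure" and x where "controlled_path N m (\<lambda>z. z) \<mu>' x"
      by (rule closed_loop_realisation[OF Fm M v0 ae V Z inv m \<mu>' id])
    then interpret N: controlled_path N m "\<lambda>z. z" \<mu>' x .
    show "average_cost m (stationary m (\<lambda>z. z)) \<mu>' = 0"
      using N.average_cost_stationary[OF costm costa]
      by (simp add: cm Limsup_const zero_ereal_def[symmetric])
    show "discounted_cost m \<beta> (stationary m (\<lambda>z. z)) \<mu>' = 0" if "0 < \<beta>" "\<beta> < 1"
      using N.discounted_cost_stationary[OF costm costa that] by (simp add: cm)
  qed
  \<comment> \<open>Fixed before \<open>n\<close>, the policy and the discount factor, so the final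
    constant depends on none of them.\<close>
  obtain \<rho> where \<rho>: "\<rho> > 0"
    "\<And>n Y. n \<ge> 1 \<Longrightarrow> finite Y \<Longrightarrow> card Y \<le> n \<Longrightarrow>
      measure D (\<Union>y\<in>Y. cball y (\<rho> * (1 / real n) powr (1 / real CARD('d)))) \<le> 1 / 2"
    using density_union_cball[OF gm, of "1 / 2"] D.finite_measure_axioms by (auto simp: D_def)
  have lower: "0 < \<beta> \<Longrightarrow> \<beta> < 1 \<Longrightarrow> \<rho> / 2 / (1 - \<beta>) * (1 / real n) powr (1 / real CARD('d)) \<le> discounted_cost m \<beta> (stationary m (f \<circ> Q n)) \<mu>"
    and lower_avg: "ereal (\<rho> / 2 * (1 / real n) powr (1 / real CARD('d))) \<le> average_cost m (stationary m (f \<circ> Q n)) \<mu>"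
    if n: "n \<ge> 1" and f: "f \<in> states (m_approx n) \<rightarrow>\<^sub>M actions (m_approx n)" for n f \<beta>
  proof -
    define r where "r = \<rho> * (1 / real n) powr (1 / real CARD('d))"
    have r0: "r \<ge> 0" using \<rho> by (simp add: r_def)
    define Y where "Y = f ` Zn n"
    \<comment> \<open>An infinite set has \<open>card\<close> 0, so \<open>n \<ge> 1\<close> forces
      finiteness.\<close>
    have finZ: "finite (Zn n)" "card (Zn n) = n" using Zn[OF n] n by (auto intro: card_ge_0_finite)
    have Y: "finite Y" "card Y \<le> n" using finZ card_image_le[of "Zn n" f] by (auto simp: Y_def)
    have Qm: "Q n \<in> states m \<rightarrow>\<^sub>M count_space (Zn n)" using Qn[OF n] by (simp add: nearest_neighbour_map_def st)
    have fQ: "f \<circ> Q n \<in> states m \<rightarrow>\<^sub>M actions m"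
      using f by (intro measurable_comp[OF Qm]) (simp add: ma approx_mdp_def)
    obtain N :: "(nat \<Rightarrow> real ^ 'd) measure" and x where "controlled_path N m (f \<circ> Q n) \<mu> x"
      and x0: "distr N (states m) (x 0) = \<mu>"
      and step: "\<forall>U\<in>sets borel. \<forall>c t. (\<forall>y. measure M {\<omega> \<in> space M. y + v 0 \<omega> \<in> U} \<le> c) \<longrightarrow>
        measure N {\<omega> \<in> space N. x (Suc t) \<omega> \<in> U} \<le> c"
      by (rule closed_loop_realisation[OF Fm M v0 ae V Z inv m \<mu> fQ])
    then interpret N: controlled_path N m "f \<circ> Q n" \<mu> x by simp
    note [measurable] = N.path_measurable
    have xb[measurable]: "x t \<in> borel_measurable N" for t
      using measurable_compose[OF N.path_measurable, of "\<lambda>x. x" borel] by (simp add: st measurable_restrict_space1)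
    have xZ: "x t \<omega> \<in> Z" if "\<omega> \<in> space N" for t \<omega>
      using measurable_space[OF N.path_measurable that] by (simp add: st space_restrict_space)
    define U where "U = (\<Union>y\<in>Y. cball y r)"
    have U[measurable]: "U \<in> sets borel" unfolding U_def using Y by (auto intro!: sets.finite_UN)
    have probU: "N.prob {\<omega> \<in> space N. x t \<omega> \<in> U} \<le> 1 / 2" for t
    proof (cases t)
      case 0
      \<comment> \<open>At time 0 no noise has acted yet; the initial law itself has density
        \<open>g\<close>.\<close>
      have "N.prob {\<omega> \<in> space N. x 0 \<omega> \<in> U} = measure (distr N (states m) (x 0)) (U \<inter> Z)"
        using xZ by (subst measure_distr[OF N.path_measurable]) (auto simp: st sets_restrict_space intro!: arg_cong[where f="measure N"])
      also have "\<dots> = measure D (U \<inter> Z)"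
        unfolding x0 \<mu>_def D_def[symmetric] by (rule measure_restrict_space) (auto simp: sets_eq_imp_space_eq[OF sD] sD)
      also have "\<dots> \<le> measure D U" by (intro D.finite_measure_mono) (auto simp: sD)
      also have "\<dots> \<le> 1 / 2" using \<rho>(2)[OF n Y] by (simp add: U_def r_def)
      finally show ?thesis using 0 by simp
    next
      case (Suc s)
      have "measure M {\<omega> \<in> space M. y + v 0 \<omega> \<in> U} \<le> 1 / 2" for y
      proof -
        \<comment> \<open>Shifting the state by \<open>y\<close> moves the centres by
          -\<open>y\<close>; their number does not grow, so the bound for \<open>\<rho>\<close>
          applies to the shifted set.\<close>
        let ?Y = "(\<lambda>u. u - y) ` Y"
        have "(y + w \<in> U) = (w \<in> (\<Union>u\<in>?Y. cball u r))" for w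
          by (auto simp: U_def dist_norm algebra_simps)
        then have "measure M {\<omega> \<in> space M. y + v 0 \<omega> \<in> U} = measure D (\<Union>u\<in>?Y. cball u r)"
          using Dv[of "\<Union>u\<in>?Y. cball u r"] Y by (simp add: sets.finite_UN)
        also have "\<dots> \<le> 1 / 2"
          using \<rho>(2)[OF n, of ?Y] Y card_image_le[of Y "\<lambda>u. u - y"] by (simp add: r_def)
        finally show ?thesis .
      qed
      then show ?thesis using step U Suc by blast
    qed
    let ?e = "\<lambda>t. \<integral>\<omega>. cost m (x t \<omega>) ((f \<circ> Q n) (x t \<omega>)) \<partial>N"
    \<comment> \<open>Outside \<open>U\<close> every available action is farther than
      \<open>r\<close> from the state, and this has probability at least 1/2.\<close>
    have e: "r / 2 \<le> ?e t" for t
    proof -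
      have "r * (1 - 1 / 2) \<le> ?e t"
      proof (rule N.integral_ge_if_prob_le[OF _ _ _ probU r0])
        show "integrable N (\<lambda>\<omega>. cost m (x t \<omega>) ((f \<circ> Q n) (x t \<omega>)))"
          by (rule N.integrable_stage_cost[OF costm costa])
        fix \<omega> assume \<omega>: "\<omega> \<in> space N" "\<omega> \<notin> {\<omega> \<in> space N. x t \<omega> \<in> U}"
        have "f (Q n (x t \<omega>)) \<in> Y"
          using measurable_space[OF Qm, of "x t \<omega>"] xZ[OF \<omega>(1)] by (simp add: Y_def st space_restrict_space)
        with \<omega> show "r \<le> cost m (x t \<omega>) ((f \<circ> Q n) (x t \<omega>))"
          by (force simp: cm U_def dist_norm norm_minus_commute)
      qed (auto simp: cm)
      then show ?thesis by simp
    qed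
    show "ereal (\<rho> / 2 * (1 / real n) powr (1 / real CARD('d))) \<le> average_cost m (stationary m (f \<circ> Q n)) \<mu>"
    proof (subst N.average_cost_stationary[OF costm], erule (1) costa, rule le_Limsup)
      \<comment> \<open>T = 0 is excluded, since there the average is 0 by the convention 1/0 = 0;
        the limsup is unaffected.\<close>
      have "\<rho> / 2 * (1 / real n) powr (1 / real CARD('d)) \<le> 1 / real T * (\<Sum>t<T. ?e t)" if "T \<ge> 1" for T
        using sum_mono[of "{..<T}" "\<lambda>_. r / 2" ?e, OF e] that by (simp add: r_def field_simps)
      then show "\<forall>\<^sub>F T in sequentially. ereal (\<rho> / 2 * (1 / real n) powr (1 / real CARD('d))) \<le> ereal (1 / real T * (\<Sum>t<T. ?e t))"
        unfolding eventually_sequentially by (intro exI[of _ 1]) simp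
    qed simp
    show "\<rho> / 2 / (1 - \<beta>) * (1 / real n) powr (1 / real CARD('d)) \<le> discounted_cost m \<beta> (stationary m (f \<circ> Q n)) \<mu>"
      if \<beta>: "0 < \<beta>" "\<beta> < 1"
    proof -
      have "?e t \<le> C + C" for t
      proof -
        have "?e t \<le> (\<integral>\<omega>. C + C \<partial>N)"
          using costb measurable_space[OF N.path_measurable] measurable_space[OF measurable_compose[OF N.path_measurable fQ]]
          by (intro integral_mono N.integrable_stage_cost[OF costm costa]) auto
        then show ?thesis by (simp add: N.prob_space)
      qed
      moreover have "0 \<le> ?e t" for t using e[of t] r0 by simp
      \<comment> \<open>Termwise comparison of the two series requires both to converge, hence this
        upper bound beside the lower one.\<close>
      ultimately have "\<bar>?e t\<bar> \<le> C + C" for t by (simp add: abs_of_nonneg)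
      then have "(\<Sum>t. \<beta> ^ t * (r / 2)) \<le> (\<Sum>t. \<beta> ^ t * ?e t)"
        using \<beta> r0 by (intro suminf_le mult_left_mono e summable_discounted[OF \<beta>, where C="C + C"] summable_mult2 summable_geometric) auto
      \<comment> \<open>The geometric series is the origin of the factor 1/(1 - \<beta>).\<close>
      moreover have "(\<Sum>t. \<beta> ^ t * (r / 2)) = r / 2 / (1 - \<beta>)"
        using \<beta> by (subst suminf_mult2[symmetric]) (auto simp: suminf_geometric)
      moreover have "discounted_cost m \<beta> (stationary m (f \<circ> Q n)) \<mu> = (\<Sum>t. \<beta> ^ t * ?e t)"
        by (rule N.discounted_cost_stationary[OF costm _ \<beta>]) (erule (1) costa)
      ultimately show ?thesis by (simp add: r_def mult_ac)
    qed
  qed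
  show ?thesis
  proof (intro conjI ballI exI[of _ "\<rho> / 2"] allI impI)
    fix \<beta> :: real assume \<beta>: "\<beta> \<in> {0<..<1}"
    show "optimal_stationary m (discounted_cost m \<beta>) (space (prob_algebra (states m))) (\<lambda>z. z)"
      unfolding optimal_stationary_def using id zero(2) \<beta> discounted_cost_nonneg[OF tr _ _ _ _ costb] by simp
    show "discounted_cost m \<beta> (stationary m (\<lambda>z. z)) \<mu> = 0" using zero(2)[OF \<mu>] \<beta> by simp
    fix n :: nat and f
    assume "1 \<le> n" "optimal_stationary (m_approx n) (discounted_cost (m_approx n) \<beta>) (dirac_distributions (m_approx n)) f"
    then show "\<rho> / 2 / (1 - \<beta>) * (1 / real n) powr (1 / real CARD('d)) \<le>
        \<bar>discounted_cost m \<beta> (stationary m (\<lambda>z. z)) \<mu> - discounted_cost m \<beta> (stationary m (f \<circ> Q n)) \<mu>\<bar>"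
      using lower[of n f \<beta>] zero(2)[OF \<mu>] \<beta> by (auto simp: optimal_stationary_def)
  next
    show "optimal_stationary m (average_cost m) (space (prob_algebra (states m))) (\<lambda>z. z)"
      unfolding optimal_stationary_def using id zero(1) average_cost_nonneg[OF tr _ _ costb[THEN conjunct1]] by simp
    show "average_cost m (stationary m (\<lambda>z. z)) \<mu> = 0" by (rule zero(1)[OF \<mu>])
    show "\<rho> / 2 > 0" using \<rho> by simp
    fix n :: nat and f
    assume n: "1 \<le> n" and "optimal_stationary (m_approx n) (average_cost (m_approx n)) (dirac_distributions (m_approx n)) f"
    then have "ereal (\<rho> / 2 * (1 / real n) powr (1 / real CARD('d))) \<le> average_cost m (stationary m (f \<circ> Q n)) \<mu>"
      by (intro lower_avg) (auto simp: optimal_stationary_def)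
    \<comment> \<open>The average cost is an \<open>ereal\<close>, so infinite values are treated as
      separate cases.\<close>
    also have "\<dots> \<le> \<bar>average_cost m (stationary m (\<lambda>z. z)) \<mu> - average_cost m (stationary m (f \<circ> Q n)) \<mu>\<bar>"
      by (cases "average_cost m (stationary m (f \<circ> Q n)) \<mu>") (simp_all add: zero(1)[OF \<mu>])
    finally show "ereal (\<rho> / 2 * (1 / real n) powr (1 / real CARD('d))) \<le>
      \<bar>average_cost m (stationary m (\<lambda>z. z)) \<mu> - average_cost m (stationary m (f \<circ> Q n)) \<mu>\<bar>" .
  qed
qed

end
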